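(* There exist graph automatic groups that are not finitely presented (and hence not automatic).
   Context: For a finite alphabet $\Sigma$, let $\Sigma^\star$ be the set of finite strings over $\Sigma$. For strings $w_1,\dots,w_n\in\Sigma^\star$ the convolution $\otimes(w_1,\dots,w_n)$ is the string of length $\max_i|w_i|$ over the alphabet $(\Sigma\cup\{\diamond\})^n$ (with $\diamond\notin\Sigma$) whose $k$-th symbol is $(\sigma_1,\dots,\sigma_n)$, where $\sigma_i$ is the $k$-th symbol of $w_i$ if $k\le|w_i|$ and $\sigma_i=\diamond$ otherwise. A relation $R\subseteq(\Sigma^\star)^n$ is FA recognizable if $\{\otimes(w_1,\dots,w_n)\mid (w_1,\dots,w_n)\in R\}$ is a regular language (recognized by a finite automaton). Let $G$ be a group generated by a finite set $X$. Its Cayley graph $\Gamma(G,X)$ is viewed as the structure $(G;(E_x)_{x\in X})$ with $E_x=\{(g,gx)\mid g\in G\}$. The group $G$ is graph automatic with respect to $X$ if there are a finite alphabet $\Sigma$, a regular language $R\subseteq\Sigma^\star$ and a bijection $\nu:R\to G$ such that for each $x\in X$ the relation $\{(u,v)\in R^2\mid \nu(u)x=\nu(v)\}$ is FA recognizable. A finitely generated group is graph automatic if it is graph automatic with respect to some finite generating set. A group $G$ is automatic (in the sense of Thurston) if for some finite generating set $X$ there is a regular language $L\subseteq X^\star$ such that the natural map $w\mapsto\bar w$ from $L$ to $G$ is onto, $\{(u,v)\in L^2\mid\bar u=\bar v\}$ is FA recognizable, and for each $x\in X$ the relation $\{(u,v)\in L^2\mid\bar u=\overline{vx}\}$ is FA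 recognizable. (Every automatic group is finitely presented, a known fact.) *)

theory Defs
  imports "HOL-Algebra.Generated_Groups"
begin

subsection \<open>Finite automata and recognizable relations\<close>

record ('s, 'a) nfa =
  nfa_states :: "'s set"
  nfa_init :: "'s set"
  nfa_trans :: "('s \<times> 'a \<times> 's) set"
  nfa_final :: "'s set"

definition nfa_over :: "'a set \<Rightarrow> ('s, 'a) nfa \<Rightarrow> bool" where
  "nfa_over \<Sigma> M \<longleftrightarrow>
     finite \<Sigma> \<and> finite (nfa_states M) \<and>
     nfa_init M \<subseteq> nfa_states M \<and> nfa_final M \<subseteq> nfa_states M \<and>
     nfa_trans M \<subseteq> nfa_states M \<times> \<Sigma> \<times> nfa_states M"

fun nfa_path :: "('s, 'a) nfa \<Rightarrow> 's \<Rightarrow> 'a list \<Rightarrow> 's \<Rightarrow> bool" where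
  "nfa_path M p [] q \<longleftrightarrow> p = q"
| "nfa_path M p (a # w) q \<longleftrightarrow> (\<exists>r. (p, a, r) \<in> nfa_trans M \<and> nfa_path M r w q)"

definition nfa_lang :: "('s, 'a) nfa \<Rightarrow> 'a list set" where
  "nfa_lang M = {w. \<exists>p \<in> nfa_init M. \<exists>q \<in> nfa_final M. nfa_path M p w q}"

text \<open>States are taken to be natural numbers, without loss of generality since
  the state set is finite.\<close>

definition regular_language :: "'a set \<Rightarrow> 'a list set \<Rightarrow> bool" where
  "regular_language \<Sigma> L \<longleftrightarrow> (\<exists>M :: (nat, 'a) nfa. nfa_over \<Sigma> M \<and> nfa_lang M = L)"

text \<open>An $n$-tuple of strings is a list of length $n$, and so is a symbol of the
  alphabet $(\Sigma \cup \{\diamond\})^n$; the padding symbol $\diamond$ is \<^term>\<open>None\<close>.\<close>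

definition padded_alphabet :: "nat \<Rightarrow> 'a set \<Rightarrow> 'a option list set" where
  "padded_alphabet n \<Sigma> = {\<sigma>. length \<sigma> = n \<and> set \<sigma> \<subseteq> insert None (Some ` \<Sigma>)}"

definition convolution :: "'a list list \<Rightarrow> 'a option list list" where
  "convolution ws =
     map (\<lambda>k. map (\<lambda>w. if k < length w then Some (w ! k) else None) ws)
         [0..<foldr max (map length ws) 0]"

definition fa_recognizable :: "nat \<Rightarrow> 'a set \<Rightarrow> 'a list list set \<Rightarrow> bool" where
  "fa_recognizable n \<Sigma> R \<longleftrightarrow>
     R \<subseteq> {ws. length ws = n \<and> set ws \<subseteq> lists \<Sigma>} \<and>
     regular_language (padded_alphabet n \<Sigma>) (convolution ` R)"

subsection \<open>Graph automatic and automatic groups\<close>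

definition finite_generating_set :: "('g, 'm) monoid_scheme \<Rightarrow> 'g set \<Rightarrow> bool" where
  "finite_generating_set G X \<longleftrightarrow> finite X \<and> X \<subseteq> carrier G \<and> generate G X = carrier G"

text \<open>Every finite alphabet can be renamed to a finite set of natural numbers.\<close>

definition graph_automatic_wrt :: "('g, 'm) monoid_scheme \<Rightarrow> 'g set \<Rightarrow> bool" where
  "graph_automatic_wrt G X \<longleftrightarrow>
     (\<exists>(\<Sigma> :: nat set) R \<nu>.
        finite \<Sigma> \<and> regular_language \<Sigma> R \<and> bij_betw \<nu> R (carrier G) \<and>
        (\<forall>x \<in> X. fa_recognizable 2 \<Sigma>
           {[u, v] | u v. u \<in> R \<and> v \<in> R \<and> \<nu> u \<otimes>\<^bsub>G\<^esub> x = \<nu> v}))"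

definition graph_automatic :: "('g, 'm) monoid_scheme \<Rightarrow> bool" where
  "graph_automatic G \<longleftrightarrow> (\<exists>X. finite_generating_set G X \<and> graph_automatic_wrt G X)"

definition word_value :: "('g, 'm) monoid_scheme \<Rightarrow> 'g list \<Rightarrow> 'g" where
  "word_value G w = foldr (\<lambda>x g. x \<otimes>\<^bsub>G\<^esub> g) w \<one>\<^bsub>G\<^esub>"

text \<open>The words in \<open>L\<close> are positive words over \<open>X\<close>; surjectivity of the evaluation
  map forces \<open>X\<close> to generate \<open>G\<close> as a monoid.\<close>

definition automatic :: "('g, 'm) monoid_scheme \<Rightarrow> bool" where
  "automatic G \<longleftrightarrow>
     (\<exists>X L. finite_generating_set G X \<and> L \<subseteq> lists X \<and> regular_language X L \<and>
        word_value G ` L = carrier G \<and>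
        fa_recognizable 2 X
          {[u, v] | u v. u \<in> L \<and> v \<in> L \<and> word_value G u = word_value G v} \<and>
        (\<forall>x \<in> X. fa_recognizable 2 X
          {[u, v] | u v. u \<in> L \<and> v \<in> L \<and> word_value G u = word_value G (v @ [x])}))"

subsection \<open>Free groups and finite presentations\<close>

text \<open>The letter \<open>(x, True)\<close> stands for $x$ and \<open>(x, False)\<close> for $x^{-1}$. The
  elements of the free group are the freely reduced words.\<close>

definition inv_letter :: "'x \<times> bool \<Rightarrow> 'x \<times> bool" where
  "inv_letter a = (fst a, \<not> snd a)"

fun reduced :: "('x \<times> bool) list \<Rightarrow> bool" where
  "reduced (a # b # w) \<longleftrightarrow> b \<noteq> inv_letter a \<and> reduced (b # w)"
| "reduced _ \<longleftrightarrow> True"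

fun cons_cancel :: "'x \<times> bool \<Rightarrow> ('x \<times> bool) list \<Rightarrow> ('x \<times> bool) list" where
  "cons_cancel a [] = [a]"
| "cons_cancel a (b # w) = (if b = inv_letter a then w else a # b # w)"

definition free_reduce :: "('x \<times> bool) list \<Rightarrow> ('x \<times> bool) list" where
  "free_reduce w = foldr cons_cancel w []"

definition free_group :: "'x set \<Rightarrow> ('x \<times> bool) list monoid" where
  "free_group X =
     \<lparr>carrier = {w \<in> lists (X \<times> UNIV). reduced w},
      monoid.mult = (\<lambda>u v. free_reduce (u @ v)),
      one = []\<rparr>"

definition normal_closure :: "('g, 'm) monoid_scheme \<Rightarrow> 'g set \<Rightarrow> 'g set" where
  "normal_closure G R = \<Inter>{N. N \<lhd> G \<and> R \<subseteq> N}"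

text \<open>A finite set of abstract generators can be renamed to a set of natural numbers.\<close>

definition finitely_presented :: "('g, 'm) monoid_scheme \<Rightarrow> bool" where
  "finitely_presented G \<longleftrightarrow>
     (\<exists>(X :: nat set) R. finite X \<and> finite R \<and> R \<subseteq> carrier (free_group X) \<and>
        G \<cong> free_group X Mod normal_closure (free_group X) R)"

text \<open>Free reduction yields a group.\<close>

lemma inv_letter_inv [simp]: "inv_letter (inv_letter a) = a"
  by (simp add: inv_letter_def)

lemma inv_letter_neq [simp]: "inv_letter a \<noteq> a" "a \<noteq> inv_letter a"
  by (auto simp: inv_letter_def prod_eq_iff)

lemma reduced_tl: "reduced (a # w) \<Longrightarrow> reduced w"
  by (cases w) auto

lemma reduced_cons_cancel: "reduced w \<Longrightarrow> reduced (cons_cancel a w)"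
  by (cases w) (auto dest: reduced_tl)

lemma reduced_foldr: "reduced w \<Longrightarrow> reduced (foldr cons_cancel u w)"
  by (induction u) (auto intro: reduced_cons_cancel)

lemma cons_cancel_inv: "reduced w \<Longrightarrow> cons_cancel a (cons_cancel (inv_letter a) w) = w"
  by (cases w rule: reduced.cases) auto

lemma foldr_cons_cancel:
  "reduced w \<Longrightarrow> foldr cons_cancel (cons_cancel a u) w = cons_cancel a (foldr cons_cancel u w)"
proof (cases u)
  case (Cons b v)
  assume "reduced w"
  with Cons show ?thesis
    using cons_cancel_inv[OF reduced_foldr, of w a v] by simp
qed simp

lemma foldr_free_reduce:
  "reduced w \<Longrightarrow> foldr cons_cancel (free_reduce u) w = foldr cons_cancel u w"
  unfolding free_reduce_def by (induction u) (auto simp: foldr_cons_cancel)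

lemma free_reduce_reduced: "reduced w \<Longrightarrow> free_reduce w = w"
proof (induction w)
  case (Cons a w)
  then show ?case by (cases w) (auto simp: free_reduce_def)
qed (simp add: free_reduce_def)

lemma free_reduce_append: "reduced v \<Longrightarrow> free_reduce (u @ v) = foldr cons_cancel u v"
  using free_reduce_reduced[of v] by (simp add: free_reduce_def)

lemma set_cons_cancel: "set (cons_cancel a w) \<subseteq> insert a (set w)"
  by (cases w) auto

lemma set_free_reduce: "set (free_reduce w) \<subseteq> set w"
  unfolding free_reduce_def by (induction w) (use set_cons_cancel in fastforce)+

lemma foldr_inverse_word:
  "reduced v \<Longrightarrow> foldr cons_cancel (rev (map inv_letter w)) (foldr cons_cancel w v) = v"
proof (induction w arbitrary: v)
  case (Cons a w)
  then show ?case
    using cons_cancel_inv[OF reduced_foldr, of v "inv_letter a" w] by simp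
qed simp

lemma group_free_group: "group (free_group X)"
proof (rule groupI)
  fix u v assume "u \<in> carrier (free_group X)" "v \<in> carrier (free_group X)"
  then show "u \<otimes>\<^bsub>free_group X\<^esub> v \<in> carrier (free_group X)"
    using set_free_reduce[of "u @ v"] reduced_foldr[of "[]" "u @ v"]
    by (auto simp: free_group_def free_reduce_def)
next
  fix u v w
  assume "u \<in> carrier (free_group X)" "v \<in> carrier (free_group X)" "w \<in> carrier (free_group X)"
  then have r: "reduced u" "reduced v" "reduced w"
    by (auto simp: free_group_def)
  show "u \<otimes>\<^bsub>free_group X\<^esub> v \<otimes>\<^bsub>free_group X\<^esub> w = u \<otimes>\<^bsub>free_group X\<^esub> (v \<otimes>\<^bsub>free_group X\<^esub> w)"
  proof -
    have "free_reduce (free_reduce (u @ v) @ w) = foldr cons_cancel (u @ v) w"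
      using free_reduce_append[OF r(3)] foldr_free_reduce[OF r(3)] by metis
    moreover have "free_reduce (u @ free_reduce (v @ w)) = foldr cons_cancel u (foldr cons_cancel v w)"
      using r by (simp add: free_reduce_append reduced_foldr)
    ultimately show ?thesis
      by (simp add: free_group_def)
  qed
next
  fix u assume u: "u \<in> carrier (free_group X)"
  define v where "v = free_reduce (rev (map inv_letter u))"
  have "reduced u" "u \<in> lists (X \<times> UNIV)"
    using u by (auto simp: free_group_def)
  then have "v \<otimes>\<^bsub>free_group X\<^esub> u = \<one>\<^bsub>free_group X\<^esub>"
    using foldr_inverse_word[of "[]" u] free_reduce_reduced[of u]
    by (simp add: free_group_def v_def free_reduce_append foldr_free_reduce)
       (simp add: free_reduce_def)
  moreover have "v \<in> carrier (free_group X)"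
    using set_free_reduce[of "rev (map inv_letter u)"] \<open>u \<in> lists _\<close>
    by (fastforce simp: free_group_def v_def inv_letter_def free_reduce_def intro: reduced_foldr)
  ultimately show "\<exists>v \<in> carrier (free_group X). v \<otimes>\<^bsub>free_group X\<^esub> u = \<one>\<^bsub>free_group X\<^esub>"
    by blast
next
  fix u assume "u \<in> carrier (free_group X)"
  then show "\<one>\<^bsub>free_group X\<^esub> \<otimes>\<^bsub>free_group X\<^esub> u = u"
    by (simp add: free_group_def free_reduce_reduced)
qed (simp add: free_group_def)

end

theory Submission
  imports Defs "HOL-Library.Countable"
begin

text \<open>The group is the lamplighter group of finitely supported lamp configurations on the
  integers together with a position. It is graph automatic with the tape folded at the origin:
  toggling a lamp or moving one step changes a normal form only at cells next to the head.

  Finite presentability and automaticity both imply that every map from \<open>G\<close> into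
  self-maps of a set which is multiplicative on a suitable finite set of pairs agrees, on a given
  finite set, with a homomorphism. For finite presentations this is von Dyck's theorem; for
  automatic groups it is the fellow traveller property, which reduces every relation to finitely
  many local ones. The lamplighter group violates this: letting lamp \<open>i\<close> swap \<open>i\<close> and \<open>i + N\<close>
  is multiplicative on any prescribed finite set once \<open>N\<close> is large, but the swaps of lamps
  \<open>0\<close> and \<open>N\<close> do not commute.\<close>

subsection \<open>Extending partial homomorphisms\<close>

text \<open>The quantifier order carries the argument: \<open>S\<close> may depend on
  \<open>T\<close> but is chosen before \<phi>, so a counterexample may adapt \<phi> to
  \<open>S\<close>; this is what lets \<open>N\<close> grow. The property names neither generators
  nor relators, so it serves both negative claims at once and is invariant under isomorphism.
  Algebraically, any finite set of relations of the lamplighter group already follows from the lamp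
  being an involution and from the commuting of lamps at bounded distance; the swaps realise a group
  in which only those commutations are imposed. Folding answers a different difficulty: a tape
  growing to both sides would renumber its letters whenever it grows to the left, while on the
  folded tape each cell keeps its index, so the two tracks of a convolution stay aligned.\<close>

definition partial_homs_extend :: "('g, 'm) monoid_scheme \<Rightarrow> bool" where
  "partial_homs_extend G \<longleftrightarrow>
     (\<forall>T. finite T \<and> T \<subseteq> carrier G \<longrightarrow>
       (\<exists>S. finite S \<and> S \<subseteq> carrier G \<times> carrier G \<and>
         (\<forall>\<phi> :: 'g \<Rightarrow> int \<Rightarrow> int.
            \<phi> \<one>\<^bsub>G\<^esub> = id \<and> (\<forall>(x, y) \<in> S. \<phi> (x \<otimes>\<^bsub>G\<^esub> y) = \<phi> x \<circ> \<phi> y) \<longrightarrow>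
            (\<exists>\<Psi>. (\<forall>x \<in> carrier G. \<forall>y \<in> carrier G. \<Psi> (x \<otimes>\<^bsub>G\<^esub> y) = \<Psi> x \<circ> \<Psi> y) \<and>
                 (\<forall>x \<in> T. \<Psi> x = \<phi> x)))))"

text \<open>The products met when \<open>w\<close> is multiplied out from its right end. They are
  finitely many, so multiplicativity at all of them can be demanded through
  \<open>S\<close>.\<close>

fun word_steps :: "('g, 'm) monoid_scheme \<Rightarrow> 'g list \<Rightarrow> ('g \<times> 'g) set" where
  "word_steps G [] = {}"
| "word_steps G (x # w) = insert (x, word_value G w) (word_steps G w)"

lemma word_value_simps [simp]:
  "word_value G [] = \<one>\<^bsub>G\<^esub>"
  "word_value G (x # w) = x \<otimes>\<^bsub>G\<^esub> word_value G w"
  by (simp_all add: word_value_def)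

lemma finite_word_steps [simp]: "finite (word_steps G w)"
  by (induction w) auto

text \<open>Without a start value, \<open>foldr \<phi> w\<close> is itself a self-map: the composite
  of the images of the letters, the leftmost applied last. The condition at the identity covers the
  empty word.\<close>

lemma foldr_eq_word_value:
  assumes "\<phi> \<one>\<^bsub>G\<^esub> = id" "\<forall>(x, y) \<in> word_steps G w. \<phi> (x \<otimes>\<^bsub>G\<^esub> y) = \<phi> x \<circ> \<phi> y"
  shows "foldr \<phi> w = \<phi> (word_value G w)"
  using assms(2) by (induction w) (auto simp: assms(1) fun_eq_iff)

context group
begin

lemma word_value_closed [simp]: "w \<in> lists (carrier G) \<Longrightarrow> word_value G w \<in> carrier G"
  by (induction w) auto

lemma word_value_append [simp]:
  "u \<in> lists (carrier G) \<Longrightarrow> v \<in> lists (carrier G) \<Longrightarrow>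
     word_value G (u @ v) = word_value G u \<otimes> word_value G v"
  by (induction u) (auto simp: m_assoc)

lemma word_steps_subset: "w \<in> lists (carrier G) \<Longrightarrow> word_steps G w \<subseteq> carrier G \<times> carrier G"
  by (induction w) auto

text \<open>Reduces the property to words: it suffices that equal values force equal composites,
  with an \<open>S0\<close> independent of \<open>T\<close>. The extension sends an element to the
  composite along a fixed representing word.\<close>

lemma partial_homs_extendI:
  assumes Y: "Y \<subseteq> carrier G" "word_value G ` lists Y = carrier G"
    and S0: "finite S0" "S0 \<subseteq> carrier G \<times> carrier G"
    and words: "\<And>(\<phi> :: 'a \<Rightarrow> int \<Rightarrow> int) u v. \<phi> \<one> = id \<Longrightarrow>
      \<forall>(x, y) \<in> S0. \<phi> (x \<otimes> y) = \<phi> x \<circ> \<phi> y \<Longrightarrow>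
      u \<in> lists Y \<Longrightarrow> v \<in> lists Y \<Longrightarrow> word_value G u = word_value G v \<Longrightarrow> foldr \<phi> u = foldr \<phi> v"
  shows "partial_homs_extend G"
  unfolding partial_homs_extend_def
proof (intro allI impI, elim conjE)
  fix T assume T: "finite T" "T \<subseteq> carrier G"
  define rep where "rep g = (SOME w. w \<in> lists Y \<and> word_value G w = g)" for g
  have rep: "rep g \<in> lists Y" "word_value G (rep g) = g" if "g \<in> carrier G" for g
  proof -
    have "\<exists>w. w \<in> lists Y \<and> word_value G w = g"
      using that Y(2) by (metis imageE)
    from someI_ex[OF this] show "rep g \<in> lists Y" "word_value G (rep g) = g"
      by (auto simp: rep_def)
  qed
  have lists_Y: "w \<in> lists (carrier G)" if "w \<in> lists Y" for w
    using that Y(1) by auto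
  \<comment> \<open>\<open>S0\<close> makes the extension multiplicative; the word steps of the
    representatives tie it to \<phi> on \<open>T\<close>.\<close>
  define S where "S = S0 \<union> (\<Union>g \<in> T. word_steps G (rep g))"
  have "finite S"
    using S0(1) T(1) by (simp add: S_def)
  moreover have "S \<subseteq> carrier G \<times> carrier G"
  proof -
    have "word_steps G (rep g) \<subseteq> carrier G \<times> carrier G" if "g \<in> T" for g
      using word_steps_subset lists_Y rep(1) T(2) that by blast
    then show ?thesis
      using S0(2) by (auto simp: S_def)
  qed
  moreover have "\<exists>\<Psi>. (\<forall>x \<in> carrier G. \<forall>y \<in> carrier G. \<Psi> (x \<otimes> y) = \<Psi> x \<circ> \<Psi> y) \<and> (\<forall>x \<in> T. \<Psi> x = \<phi> x)"
    if \<phi>: "\<phi> \<one> = id" "\<forall>(x, y) \<in> S. \<phi> (x \<otimes> y) = \<phi> x \<circ> \<phi> y" for \<phi> :: "'a \<Rightarrow> int \<Rightarrow> int"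
  proof (intro exI conjI ballI)
    fix x y assume xy: "x \<in> carrier G" "y \<in> carrier G"
    have "foldr \<phi> (rep (x \<otimes> y)) = foldr \<phi> (rep x @ rep y)"
    proof (rule words)
      show "\<forall>(x, y) \<in> S0. \<phi> (x \<otimes> y) = \<phi> x \<circ> \<phi> y"
        using \<phi>(2) by (auto simp: S_def)
      show "rep x @ rep y \<in> lists Y" "rep (x \<otimes> y) \<in> lists Y"
        using rep(1) xy by auto
      show "word_value G (rep (x \<otimes> y)) = word_value G (rep x @ rep y)"
        using rep xy lists_Y by simp
    qed (fact \<phi>(1))
    \<comment> \<open>The witness was left open and is fixed here as
      \<open>\<lambda>x. foldr \<phi> (rep x)\<close>.\<close>
    then show "foldr \<phi> (rep (x \<otimes> y)) = foldr \<phi> (rep x) \<circ> foldr \<phi> (rep y)"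
      by (simp add: fun_eq_iff)
  next
    fix x assume x: "x \<in> T"
    then have "foldr \<phi> (rep x) = \<phi> (word_value G (rep x))"
      using \<phi> by (intro foldr_eq_word_value) (auto simp: S_def)
    then show "foldr \<phi> (rep x) = \<phi> x"
      using rep(2) x T(2) by auto
  qed
  ultimately show "\<exists>S. finite S \<and> S \<subseteq> carrier G \<times> carrier G \<and>
      (\<forall>\<phi> :: 'a \<Rightarrow> int \<Rightarrow> int. \<phi> \<one> = id \<and> (\<forall>(x, y) \<in> S. \<phi> (x \<otimes> y) = \<phi> x \<circ> \<phi> y) \<longrightarrow>
         (\<exists>\<Psi>. (\<forall>x \<in> carrier G. \<forall>y \<in> carrier G. \<Psi> (x \<otimes> y) = \<Psi> x \<circ> \<Psi> y) \<and> (\<forall>x \<in> T. \<Psi> x = \<phi> x)))"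
    by blast
qed

end

text \<open>Bridges the lamplighter group and its copy on the natural numbers: \<phi> is pulled back
  along \<open>h\<close>, and the extension obtained on \<open>G\<close> is carried over by the
  inverse \<open>k\<close>.\<close>

lemma partial_homs_extend_iso:
  assumes "group G" "group H" "h \<in> iso G H" "partial_homs_extend G"
  shows "partial_homs_extend H"
  unfolding partial_homs_extend_def
proof (intro allI impI, elim conjE)
  fix T assume T: "finite T" "T \<subseteq> carrier H"
  define k where "k = inv_into (carrier G) h"
  have h: "\<And>x y. x \<in> carrier G \<Longrightarrow> y \<in> carrier G \<Longrightarrow> h (x \<otimes>\<^bsub>G\<^esub> y) = h x \<otimes>\<^bsub>H\<^esub> h y"
    "bij_betw h (carrier G) (carrier H)"
    using assms(3) by (auto simp: iso_def hom_def)
  have h_one: "h \<one>\<^bsub>G\<^esub> = \<one>\<^bsub>H\<^esub>"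
    using assms(1-3) by (simp add: hom_one iso_imp_homomorphism)
  have hk: "h (k x) = x" "k x \<in> carrier G" if "x \<in> carrier H" for x
    using that h(2) by (auto simp: k_def bij_betw_inv_into_right bij_betwE[OF bij_betw_inv_into])
  have k: "k (x \<otimes>\<^bsub>H\<^esub> y) = k x \<otimes>\<^bsub>G\<^esub> k y" if "x \<in> carrier H" "y \<in> carrier H" for x y
    using that group.iso_set_sym[OF assms(1,3)] by (auto simp: k_def iso_def hom_def)
  have kT: "finite (k ` T)" "k ` T \<subseteq> carrier G"
    using T hk(2) by auto
  from assms(4)[unfolded partial_homs_extend_def, rule_format, OF conjI, OF this]
  obtain S where S: "finite S" "S \<subseteq> carrier G \<times> carrier G"
    and ext: "\<And>\<phi> :: _ \<Rightarrow> int \<Rightarrow> int. \<phi> \<one>\<^bsub>G\<^esub> = id \<and> (\<forall>(x, y) \<in> S. \<phi> (x \<otimes>\<^bsub>G\<^esub> y) = \<phi> x \<circ> \<phi> y) \<longrightarrow>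
        (\<exists>\<Psi>. (\<forall>x \<in> carrier G. \<forall>y \<in> carrier G. \<Psi> (x \<otimes>\<^bsub>G\<^esub> y) = \<Psi> x \<circ> \<Psi> y) \<and>
          (\<forall>x \<in> k ` T. \<Psi> x = \<phi> x))"
    by (elim exE conjE) (rule that, auto)
  have "\<exists>\<Psi>. (\<forall>x \<in> carrier H. \<forall>y \<in> carrier H. \<Psi> (x \<otimes>\<^bsub>H\<^esub> y) = \<Psi> x \<circ> \<Psi> y) \<and> (\<forall>x \<in> T. \<Psi> x = \<phi> x)"
    if \<phi>: "\<phi> \<one>\<^bsub>H\<^esub> = id" "\<forall>(x, y) \<in> map_prod h h ` S. \<phi> (x \<otimes>\<^bsub>H\<^esub> y) = \<phi> x \<circ> \<phi> y"
    for \<phi> :: "_ \<Rightarrow> int \<Rightarrow> int"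
  proof -
    have "\<forall>(x, y) \<in> S. \<phi> (h (x \<otimes>\<^bsub>G\<^esub> y)) = \<phi> (h x) \<circ> \<phi> (h y)"
      using \<phi>(2) S(2) h(1) by force
    then have "\<phi> (h \<one>\<^bsub>G\<^esub>) = id \<and> (\<forall>(x, y) \<in> S. \<phi> (h (x \<otimes>\<^bsub>G\<^esub> y)) = \<phi> (h x) \<circ> \<phi> (h y))"
      using \<phi>(1) h_one by simp
    then obtain \<Psi> where
      "\<forall>x \<in> carrier G. \<forall>y \<in> carrier G. \<Psi> (x \<otimes>\<^bsub>G\<^esub> y) = \<Psi> x \<circ> \<Psi> y"
      "\<forall>x \<in> k ` T. \<Psi> x = \<phi> (h x)"
      using ext[of "\<lambda>x. \<phi> (h x)"] by blast
    then show ?thesis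
      using hk T(2) k by (intro exI[of _ "\<lambda>x. \<Psi> (k x)"]) auto
  qed
  moreover have "finite (map_prod h h ` S)" "map_prod h h ` S \<subseteq> carrier H \<times> carrier H"
    using S bij_betwE[OF h(2)] by auto
  ultimately show "\<exists>S. finite S \<and> S \<subseteq> carrier H \<times> carrier H \<and>
      (\<forall>\<phi> :: _ \<Rightarrow> int \<Rightarrow> int.
        \<phi> \<one>\<^bsub>H\<^esub> = id \<and> (\<forall>(x, y) \<in> S. \<phi> (x \<otimes>\<^bsub>H\<^esub> y) = \<phi> x \<circ> \<phi> y) \<longrightarrow>
         (\<exists>\<Psi>. (\<forall>x \<in> carrier H. \<forall>y \<in> carrier H. \<Psi> (x \<otimes>\<^bsub>H\<^esub> y) = \<Psi> x \<circ> \<Psi> y) \<and> (\<forall>x \<in> T. \<Psi> x = \<phi> x)))"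
    by blast
qed

subsection \<open>Finitely presented groups\<close>

lemma free_group_simps [simp]:
  "w \<in> carrier (free_group X) \<longleftrightarrow> w \<in> lists (X \<times> UNIV) \<and> reduced w"
  "u \<otimes>\<^bsub>free_group X\<^esub> v = free_reduce (u @ v)"
  "\<one>\<^bsub>free_group X\<^esub> = []"
  by (auto simp: free_group_def)

lemma free_reduce_simps [simp]:
  "free_reduce [] = []"
  "free_reduce (a # w) = cons_cancel a (free_reduce w)"
  by (simp_all add: free_reduce_def)

lemma reduced_free_reduce [simp]: "reduced (free_reduce w)"
  unfolding free_reduce_def by (simp add: reduced_foldr)

lemma free_reduce_in_lists: "w \<in> lists A \<Longrightarrow> free_reduce w \<in> lists A"
  using set_free_reduce[of w] by auto

lemma normal_closure_normal:
  assumes "group G" "R \<subseteq> carrier G"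
  shows "normal_closure G R \<lhd> G" "R \<subseteq> normal_closure G R"
proof -
  interpret group G by fact
  \<comment> \<open>Puts the whole group into the intersected family, which bounds the intersection
    by the carrier.\<close>
  have "carrier G \<lhd> G"
    by (simp add: normal_inv_iff subgroup_self)
  then have "normal_closure G R \<subseteq> carrier G"
    using assms(2) by (auto simp: normal_closure_def)
  moreover have "\<And>N. N \<lhd> G \<Longrightarrow> subgroup N G"
    by (simp add: normal_inv_iff)
  ultimately show "normal_closure G R \<lhd> G"
    unfolding normal_inv_iff
    by (intro conjI subgroupI)
       (auto simp: normal_closure_def normal_inv_iff subgroup.m_inv_closed subgroup.m_closed
          dest: subgroup.one_closed)
  show "R \<subseteq> normal_closure G R"
    by (auto simp: normal_closure_def)
qed

text \<open>Free reduction only deletes adjacent pairs of inverse letters, and each such pair acts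
  as the identity.\<close>

lemma foldr_free_reduce_id:
  assumes "\<And>a. a \<in> A \<Longrightarrow> \<psi> a \<circ> \<psi> (inv_letter a) = id" "w \<in> lists A"
  shows "foldr \<psi> (free_reduce w) = foldr \<psi> w"
proof -
  have cons: "foldr \<psi> (cons_cancel a v) = \<psi> a \<circ> foldr \<psi> v" if "a \<in> A" for a v
  proof (cases v)
    case (Cons b v')
    then show ?thesis
      using assms(1)[OF that] by (auto simp: fun_eq_iff)
  qed simp
  show ?thesis
    using assms(2) by (induction w) (auto simp: cons fun_eq_iff)
qed

text \<open>A normal closure is an intersection of normal subgroups, so it lies in this kernel once
  the relators do. The target is a monoid of self-maps rather than a group structure, hence the
  verification by hand.\<close>

lemma kernel_normal_in_free_group:
  assumes "\<And>a. a \<in> X \<times> UNIV \<Longrightarrow> \<psi> a \<circ> \<psi> (inv_letter a) = id"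
  shows "{w \<in> carrier (free_group X). foldr \<psi> w = id} \<lhd> free_group X"
proof -
  interpret F: group "free_group X"
    by (rule group_free_group)
  have mult: "foldr \<psi> (u \<otimes>\<^bsub>free_group X\<^esub> v) = foldr \<psi> u \<circ> foldr \<psi> v"
    if "u \<in> carrier (free_group X)" "v \<in> carrier (free_group X)" for u v
    using foldr_free_reduce_id[of "X \<times> UNIV" \<psi> "u @ v"] assms that by (auto simp: fun_eq_iff)
  have inv: "foldr \<psi> u \<circ> foldr \<psi> (inv\<^bsub>free_group X\<^esub> u) = id"
    if "u \<in> carrier (free_group X)" for u
    using mult[of u "inv\<^bsub>free_group X\<^esub> u"] F.r_inv[OF that] F.inv_closed[OF that] that
    by (metis free_group_simps(3) foldr.simps(1))
  show ?thesis
    unfolding F.normal_inv_iff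
  proof (intro conjI ballI F.subgroupI)
    fix x h
    assume x: "x \<in> carrier (free_group X)" and h: "h \<in> {w \<in> carrier (free_group X). foldr \<psi> w = id}"
    then have "foldr \<psi> (x \<otimes>\<^bsub>free_group X\<^esub> h \<otimes>\<^bsub>free_group X\<^esub> inv\<^bsub>free_group X\<^esub> x) = id"
      using mult[of "x \<otimes>\<^bsub>free_group X\<^esub> h" "inv\<^bsub>free_group X\<^esub> x"] mult[of x h] inv[of x]
        F.inv_closed[of x] F.m_closed[of x h] by simp
    then show "x \<otimes>\<^bsub>free_group X\<^esub> h \<otimes>\<^bsub>free_group X\<^esub> inv\<^bsub>free_group X\<^esub> x
        \<in> {w \<in> carrier (free_group X). foldr \<psi> w = id}"
      using F.m_closed[OF F.m_closed[of x h] F.inv_closed[of x]] x h by blast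
  next
    fix u v
    assume "u \<in> {w \<in> carrier (free_group X). foldr \<psi> w = id}"
      "v \<in> {w \<in> carrier (free_group X). foldr \<psi> w = id}"
    then show "u \<otimes>\<^bsub>free_group X\<^esub> v \<in> {w \<in> carrier (free_group X). foldr \<psi> w = id}"
      using mult[of u v] F.m_closed[of u v] by auto
  next
    fix u
    assume u: "u \<in> {w \<in> carrier (free_group X). foldr \<psi> w = id}"
    then have "foldr \<psi> (inv\<^bsub>free_group X\<^esub> u) = id"
      using inv[of u] by simp
    then show "inv\<^bsub>free_group X\<^esub> u \<in> {w \<in> carrier (free_group X). foldr \<psi> w = id}"
      using F.inv_closed[of u] u by auto
  qed (use F.one_closed in \<open>auto simp del: free_group_simps(1) simp: fun_eq_iff\<close>)
qed

lemma finitely_presented_partial_homs_extend: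
  assumes "group G" "finitely_presented G"
  shows "partial_homs_extend G"
proof -
  interpret group G by fact
  obtain X :: "nat set" and R where X: "finite X" "finite R" "R \<subseteq> carrier (free_group X)"
    and "G \<cong> free_group X Mod normal_closure (free_group X) R"
    using assms(2) unfolding finitely_presented_def by blast
  define F where "F = free_group X"
  define N where "N = normal_closure F R"
  interpret F: group F
    unfolding F_def by (rule group_free_group)
  have N: "N \<lhd> F" "R \<subseteq> N"
    using normal_closure_normal[OF F.is_group] X(3) by (auto simp: N_def F_def simp del: free_group_simps)
  interpret N: normal N F by (rule N(1))
  have "F Mod N \<cong> G"
    using iso_sym \<open>G \<cong> _\<close> unfolding F_def N_def by blast
  then obtain h where h: "h \<in> iso (F Mod N) G"
    by (auto simp: is_iso_def)
  define \<pi> where "\<pi> w = h (N #>\<^bsub>F\<^esub> w)" for w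
  have h_bij: "bij_betw h (rcosets\<^bsub>F\<^esub> N) (carrier G)"
    using h by (auto simp: iso_def FactGroup_def)
  have coset: "N #>\<^bsub>F\<^esub> w \<in> rcosets\<^bsub>F\<^esub> N" if "w \<in> carrier F" for w
    using that by (auto simp: RCOSETS_def)
  have \<pi>_hom: "\<pi> \<in> hom F G"
    using N.r_coset_hom_Mod h by (auto simp: \<pi>_def iso_def hom_def Pi_def)
  interpret \<pi>: group_hom F G \<pi>
    by (intro group_hom.intro group_hom_axioms.intro F.is_group is_group \<pi>_hom)
  have \<pi>_surj: "\<pi> ` carrier F = carrier G"
  proof -
    have "(\<lambda>w. N #>\<^bsub>F\<^esub> w) ` carrier F = rcosets\<^bsub>F\<^esub> N"
      by (auto simp: RCOSETS_def)
    then show ?thesis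
      using h_bij by (metis (no_types, lifting) \<pi>_def bij_betw_def image_cong image_image)
  qed
  have \<pi>_ker: "u \<in> N" if "u \<in> carrier F" "\<pi> u = \<one>\<^bsub>G\<^esub>" for u
  proof -
    have "\<pi> u = \<pi> \<one>\<^bsub>F\<^esub>"
      using that by simp
    then have "N #>\<^bsub>F\<^esub> u = N #>\<^bsub>F\<^esub> \<one>\<^bsub>F\<^esub>"
      using h_bij coset that(1) by (metis \<pi>_def bij_betw_def inj_onD F.one_closed)
    also have "\<dots> = N"
      using F.coset_mult_one N.subset by blast
    finally show "u \<in> N"
      using F.rcos_self[OF that(1) N.is_subgroup] by simp
  qed
  have \<pi>_N: "\<pi> u = \<one>\<^bsub>G\<^esub>" if "u \<in> N" for u
  proof -
    have "N #>\<^bsub>F\<^esub> u = N #>\<^bsub>F\<^esub> \<one>\<^bsub>F\<^esub>"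
      using N.rcos_const[OF F.is_group that] F.coset_mult_one[OF N.subset] by simp
    then show ?thesis
      using \<pi>.hom_one by (simp add: \<pi>_def)
  qed
  define A where "A = X \<times> (UNIV :: bool set)"
  define p where "p a = \<pi> [a]" for a
  have letter: "[a] \<in> carrier F" "[inv_letter a] \<in> carrier F" if "a \<in> A" for a
    using that by (auto simp: F_def A_def inv_letter_def)
  have carrier_F: "w \<in> carrier F \<longleftrightarrow> w \<in> lists A \<and> reduced w" for w
    by (simp add: F_def A_def)
  have p_closed: "p a \<in> carrier G" if "a \<in> A" for a
    using letter[OF that] by (simp add: p_def)
  have p_inv: "p a \<otimes>\<^bsub>G\<^esub> p (inv_letter a) = \<one>\<^bsub>G\<^esub>" if "a \<in> A" for a
  proof -
    have "[a] \<otimes>\<^bsub>F\<^esub> [inv_letter a] = \<one>\<^bsub>F\<^esub>"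
      by (simp add: F_def)
    then show ?thesis
      using \<pi>.hom_mult letter[OF that] \<pi>.hom_one unfolding p_def by metis
  qed
  have \<pi>_word: "\<pi> (free_reduce w) = word_value G (map p w)" if "w \<in> lists A" for w
    using that
  proof (induction w)
    case Nil
    show ?case
      using \<pi>.hom_one by (simp add: F_def)
  next
    case (Cons a w)
    then have "free_reduce w \<in> carrier F" "[a] \<in> carrier F"
      using free_reduce_in_lists[of w A] letter(1) by (auto simp: carrier_F)
    moreover have "free_reduce (a # w) = [a] \<otimes>\<^bsub>F\<^esub> free_reduce w"
      using free_reduce_append[of "free_reduce w" "[a]"] by (simp add: F_def)
    ultimately show ?case
      using Cons by (simp add: p_def)
  qed
  \<comment> \<open>The first set makes the images of a letter and of its formal inverse cancel,
    since \<phi> by itself need not respect inverses; the second makes every relator act as \<phi>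
    of its value, which is the identity.\<close>
  define S0 where "S0 = (\<lambda>a. (p a, p (inv_letter a))) ` A \<union> (\<Union>r \<in> R. word_steps G (map p r))"
  have finite_A: "finite A"
    using X(1) by (simp add: A_def)
  have inv_A: "inv_letter a \<in> A" if "a \<in> A" for a
    using that by (auto simp: A_def inv_letter_def)
  have R_lists: "r \<in> lists A" "reduced r" if "r \<in> R" for r
    using that X(3) carrier_F[of r] unfolding F_def by blast+
  have map_p: "map p w \<in> lists (carrier G)" if "w \<in> lists A" for w
    using that p_closed by auto
  show ?thesis
  proof (rule partial_homs_extendI)
    show "p ` A \<subseteq> carrier G"
      using p_closed by auto
    show "word_value G ` lists (p ` A) = carrier G"
    proof -
      have "word_value G ` lists (p ` A) = (\<lambda>w. word_value G (map p w)) ` lists A"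
        by (simp add: lists_image image_image)
      also have "\<dots> = \<pi> ` free_reduce ` lists A"
        using \<pi>_word by (simp add: image_image)
      also have "free_reduce ` lists A = carrier F"
      proof
        show "free_reduce ` lists A \<subseteq> carrier F"
          by (intro image_subsetI) (simp add: carrier_F free_reduce_in_lists del: in_lists_conv_set)
        show "carrier F \<subseteq> free_reduce ` lists A"
          using free_reduce_reduced by (metis carrier_F image_eqI subsetI)
      qed
      finally show ?thesis
        using \<pi>_surj by simp
    qed
    show "finite S0"
      using finite_A X(2) by (simp add: S0_def)
    show "S0 \<subseteq> carrier G \<times> carrier G"
    proof -
      have "word_steps G (map p r) \<subseteq> carrier G \<times> carrier G" if "r \<in> R" for r
        using word_steps_subset[OF map_p[OF R_lists(1)[OF that]]] .
      moreover have "(p a, p (inv_letter a)) \<in> carrier G \<times> carrier G" if "a \<in> A" for a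
        using p_closed inv_A that by blast
      ultimately show ?thesis
        unfolding S0_def by blast
    qed
  next
    fix \<phi> :: "'a \<Rightarrow> int \<Rightarrow> int" and y z
    assume \<phi>: "\<phi> \<one>\<^bsub>G\<^esub> = id" "\<forall>(x, y) \<in> S0. \<phi> (x \<otimes>\<^bsub>G\<^esub> y) = \<phi> x \<circ> \<phi> y"
      and yz: "y \<in> lists (p ` A)" "z \<in> lists (p ` A)" "word_value G y = word_value G z"
    from yz(1,2) obtain u' v' where u': "u' \<in> lists A" "y = map p u'"
      and v': "v' \<in> lists A" "z = map p v'"
      by (auto simp: lists_image)
    define \<psi> where "\<psi> = \<phi> \<circ> p"
    have \<psi>_inv: "\<psi> a \<circ> \<psi> (inv_letter a) = id" if "a \<in> A" for a
    proof -
      have "\<phi> (p a \<otimes>\<^bsub>G\<^esub> p (inv_letter a)) = \<phi> (p a) \<circ> \<phi> (p (inv_letter a))"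
        using \<phi>(2) that by (auto simp: S0_def)
      then show ?thesis
        using \<phi>(1) p_inv[OF that] by (simp add: \<psi>_def)
    qed
    define K where "K = {w \<in> carrier F. foldr \<psi> w = id}"
    have "K \<lhd> F"
      unfolding K_def F_def by (rule kernel_normal_in_free_group) (use \<psi>_inv A_def in blast)
    moreover have "R \<subseteq> K"
    proof
      fix r assume r: "r \<in> R"
      have "foldr \<psi> r = foldr \<phi> (map p r)"
        by (simp add: foldr_map \<psi>_def fun_eq_iff)
      also have "\<dots> = \<phi> (word_value G (map p r))"
        by (rule foldr_eq_word_value) (use \<phi> r in \<open>auto simp: S0_def\<close>)
      also have "word_value G (map p r) = \<one>\<^bsub>G\<^esub>"
        using \<pi>_word[of r] R_lists[OF r] free_reduce_reduced[of r] \<pi>_N N(2) r by auto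
      finally show "r \<in> K"
        using R_lists[OF r] \<phi>(1) by (simp add: K_def carrier_F fun_eq_iff)
    qed
    ultimately have "N \<subseteq> K"
      by (auto simp: N_def normal_closure_def)
    define u where "u = free_reduce u'"
    define v where "v = free_reduce v'"
    have uv: "u \<in> carrier F" "v \<in> carrier F"
      using u'(1) v'(1)
      by (simp_all add: carrier_F u_def v_def free_reduce_in_lists del: in_lists_conv_set)
    have \<psi>_mult: "foldr \<psi> (u \<otimes>\<^bsub>F\<^esub> v) = foldr \<psi> u \<circ> foldr \<psi> v"
      if "u \<in> carrier F" "v \<in> carrier F" for u v
      using foldr_free_reduce_id[of A \<psi> "u @ v"] \<psi>_inv that carrier_F by (auto simp: fun_eq_iff F_def)
    have "\<pi> u = \<pi> v"
      using \<pi>_word u' v' yz(3) by (simp add: u_def v_def)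
    \<comment> \<open>Words of equal value differ by an element of the kernel of \<pi>, hence of
      \<open>N\<close> and so of \<open>K\<close>.\<close>
    then have "\<pi> (u \<otimes>\<^bsub>F\<^esub> inv\<^bsub>F\<^esub> v) = \<one>\<^bsub>G\<^esub>"
      using uv by simp
    then have "u \<otimes>\<^bsub>F\<^esub> inv\<^bsub>F\<^esub> v \<in> K"
      using \<pi>_ker uv \<open>N \<subseteq> K\<close> by auto
    then have "foldr \<psi> u \<circ> foldr \<psi> (inv\<^bsub>F\<^esub> v) = id"
      using \<psi>_mult[of u "inv\<^bsub>F\<^esub> v"] uv by (simp add: K_def)
    moreover have "foldr \<psi> (inv\<^bsub>F\<^esub> v) \<circ> foldr \<psi> v = id"
      using \<psi>_mult[OF F.inv_closed[OF uv(2)] uv(2)] F.l_inv[OF uv(2)] by (simp add: F_def)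
    ultimately have "foldr \<psi> u = foldr \<psi> v"
      by (metis comp_assoc comp_id id_comp)
    then have "foldr \<psi> u' = foldr \<psi> v'"
      using foldr_free_reduce_id[of A \<psi>] \<psi>_inv u'(1) v'(1) by (simp add: u_def v_def)
    then show "foldr \<phi> y = foldr \<phi> z"
      using u'(2) v'(2) by (simp add: foldr_map \<psi>_def fun_eq_iff)
  qed
qed

subsection \<open>Automatic groups\<close>

lemma convolution_pair [simp]:
  "convolution [[], []] = []"
  "convolution [x # u, []] = [Some x, None] # convolution [u, []]"
  "convolution [[], y # v] = [None, Some y] # convolution [[], v]"
  "convolution [x # u, y # v] = [Some x, Some y] # convolution [u, v]"
  by (simp_all add: convolution_def map_upt_Suc del: upt_Suc)

lemma take_convolution_pair: "take k (convolution [u, v]) = convolution [take k u, take k v]"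
proof (induction k arbitrary: u v)
  case (Suc k)
  then show ?case
    by (cases u; cases v) (auto simp: Suc[of _ "[]", simplified] Suc[of "[]", simplified])
qed simp

lemma drop_convolution_pair: "drop k (convolution [u, v]) = convolution [drop k u, drop k v]"
proof (induction k arbitrary: u v)
  case (Suc k)
  then show ?case
    by (cases u; cases v) (auto simp: Suc[of _ "[]", simplified] Suc[of "[]", simplified])
qed simp

text \<open>Reads one component and drops its padding. It respects concatenation, so it also applies
  to a spliced word that is not visibly a convolution, and recovers the pair behind it.\<close>

definition track :: "nat \<Rightarrow> 'a option list list \<Rightarrow> 'a list" where
  "track i w = List.map_filter (\<lambda>\<sigma>. \<sigma> ! i) w"

lemma track_append [simp]: "track i (u @ v) = track i u @ track i v"
  by (simp add: track_def map_filter_def)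

lemma track_simps [simp]:
  "track i [] = []"
  "track i (\<sigma> # w) = (case \<sigma> ! i of None \<Rightarrow> track i w | Some a \<Rightarrow> a # track i w)"
  by (simp_all add: track_def map_filter_simps split: option.splits)

lemma track_convolution_Nil [simp]:
  "track 0 (convolution [u, []]) = u" "track (Suc 0) (convolution [u, []]) = []"
  "track 0 (convolution [[], u]) = []" "track (Suc 0) (convolution [[], u]) = u"
  by (induction u) simp_all

lemma track_convolution [simp]:
  "track 0 (convolution [u, v]) = u" "track (Suc 0) (convolution [u, v]) = v"
  by (induction u v rule: list_induct2') simp_all

lemma nfa_path_append:
  "nfa_path M p (u @ v) q \<longleftrightarrow> (\<exists>r. nfa_path M p u r \<and> nfa_path M r v q)"
  by (induction u arbitrary: p) auto

lemma nfa_path_closed: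
  "nfa_over \<Sigma> M \<Longrightarrow> nfa_path M p w q \<Longrightarrow> p \<in> nfa_states M \<Longrightarrow> q \<in> nfa_states M"
  by (induction w arbitrary: p) (auto simp: nfa_over_def)

context group
begin

lemma inv_mult_eq_mult_inv:
  assumes "a \<otimes> b = c \<otimes> d" "a \<in> carrier G" "b \<in> carrier G" "c \<in> carrier G" "d \<in> carrier G"
  shows "inv a \<otimes> c = b \<otimes> inv d"
proof -
  have "c = a \<otimes> b \<otimes> inv d"
    using assms by (simp add: m_assoc)
  then show ?thesis
    using assms(2-5) by (simp add: m_assoc[symmetric])
qed

text \<open>The difference between the two tracks after \<open>k\<close> letters is determined by the state of
  an accepting run at time \<open>k\<close>, because two runs through the same state can be spliced.\<close>

lemma finite_fellow_traveller_differences: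
  assumes rec: "fa_recognizable 2 X {[u, v] | u v. Q u v}"
    and X: "X \<subseteq> carrier G" and c: "c \<in> carrier G"
    and Q: "\<And>u v. Q u v \<Longrightarrow> u \<in> lists X \<and> v \<in> lists X \<and> word_value G u = word_value G v \<otimes> c"
  shows "finite {inv (word_value G (take k u)) \<otimes> word_value G (take k v) | u v k. Q u v}"
    (is "finite ?D")
proof -
  obtain M :: "(nat, 'a option list) nfa" where M: "nfa_over (padded_alphabet 2 X) M"
    and lang: "nfa_lang M = convolution ` {[u, v] | u v. Q u v}"
    using rec by (auto simp: fa_recognizable_def regular_language_def)
  define through where "through q u v k \<longleftrightarrow> Q u v \<and>
    (\<exists>p \<in> nfa_init M. nfa_path M p (take k (convolution [u, v])) q) \<and>
    (\<exists>f \<in> nfa_final M. nfa_path M q (drop k (convolution [u, v])) f)" for q u v k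
  define E where "E q = {inv (word_value G (take k u)) \<otimes> word_value G (take k v) | u v k.
    through q u v k}" for q
  have lists: "w \<in> lists (carrier G)" "take k w \<in> lists (carrier G)" "drop k w \<in> lists (carrier G)"
    if "w \<in> lists X" for w k
    using that X set_take_subset[of k w] set_drop_subset[of k w] by auto
  \<comment> \<open>For a spliced pair the prefix difference is expressed by the suffixes alone.
    Applied to the splice and to the unspliced \<open>u'\<close>, \<open>v'\<close>, it gives the
    same right-hand side.\<close>
  have split: "inv (word_value G (take k u)) \<otimes> word_value G (take k v) =
      word_value G (drop k' u') \<otimes> inv (word_value G (drop k' v') \<otimes> c)"
    if "Q (take k u @ drop k' u') (take k v @ drop k' v')" "Q u v" "Q u' v'" for u v k u' v' k'
  proof (rule inv_mult_eq_mult_inv)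
    show "word_value G (take k u) \<otimes> word_value G (drop k' u') =
      word_value G (take k v) \<otimes> (word_value G (drop k' v') \<otimes> c)"
      using Q[OF that(1)] Q[OF that(2)] Q[OF that(3)] lists c by (simp add: m_assoc)
  qed (use Q[OF that(2)] Q[OF that(3)] lists c in auto)
  have "x = y" if E: "x \<in> E q" "y \<in> E q" for x y q
  proof -
    obtain u v k where x: "x = inv (word_value G (take k u)) \<otimes> word_value G (take k v)"
      and uv: "through q u v k"
      using E(1) by (auto simp: E_def)
    obtain u' v' k' where y: "y = inv (word_value G (take k' u')) \<otimes> word_value G (take k' v')"
      and uv': "through q u' v' k'"
      using E(2) by (auto simp: E_def)
    obtain p f where "p \<in> nfa_init M" "nfa_path M p (take k (convolution [u, v])) q"
      and "f \<in> nfa_final M" "nfa_path M q (drop k' (convolution [u', v'])) f"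
      using uv uv' unfolding through_def by blast
    moreover from this
    have "nfa_path M p (take k (convolution [u, v]) @ drop k' (convolution [u', v'])) f"
      unfolding nfa_path_append by blast
    ultimately have "take k (convolution [u, v]) @ drop k' (convolution [u', v']) \<in> nfa_lang M"
      unfolding nfa_lang_def by blast
    then obtain u'' v'' where Q'': "Q u'' v''" and
      eq: "convolution [take k u, take k v] @ convolution [drop k' u', drop k' v'] = convolution [u'', v'']"
      by (auto simp: lang take_convolution_pair drop_convolution_pair)
    have "u'' = take k u @ drop k' u'" "v'' = take k v @ drop k' v'"
      using arg_cong[OF eq, of "track 0"] arg_cong[OF eq, of "track (Suc 0)"] by simp_all
    then have "x = word_value G (drop k' u') \<otimes> inv (word_value G (drop k' v') \<otimes> c)"
      using split[of k u k' u' v v'] Q'' uv uv' x by (simp add: through_def)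
    moreover have "y = word_value G (drop k' u') \<otimes> inv (word_value G (drop k' v') \<otimes> c)"
      using split[of k' u' k' u' v' v'] uv' y by (simp add: through_def)
    ultimately show ?thesis by simp
  qed
  then have "finite (E q)" for q
    by (metis finite.simps insertI1 is_singletonI' is_singleton_the_elem)
  moreover have "finite (nfa_states M)"
    using M by (simp add: nfa_over_def)
  ultimately have "finite (\<Union>q \<in> nfa_states M. E q)"
    by blast
  moreover have "?D \<subseteq> (\<Union>q \<in> nfa_states M. E q)"
  proof clarify
    fix u v k assume uv: "Q u v"
    then have "take k (convolution [u, v]) @ drop k (convolution [u, v]) \<in> nfa_lang M"
      by (auto simp: lang)
    then obtain p f q where q: "p \<in> nfa_init M" "f \<in> nfa_final M"
      "nfa_path M p (take k (convolution [u, v])) q" "nfa_path M q (drop k (convolution [u, v])) f"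
      unfolding nfa_lang_def mem_Collect_eq nfa_path_append by blast
    then have "q \<in> nfa_states M"
      using nfa_path_closed[OF M] M by (auto simp: nfa_over_def)
    moreover have "through q u v k"
      using q uv by (auto simp: through_def)
    ultimately show "inv (word_value G (take k u)) \<otimes> word_value G (take k v) \<in> (\<Union>q \<in> nfa_states M. E q)"
      by (auto simp: E_def)
  qed
  ultimately show ?thesis
    by (rule rev_finite_subset)
qed

text \<open>For a pair with \<open>u = v c\<close> in the group, let \<open>d\<close> be the
  difference of the prefixes at one time and \<open>d'\<close> at the next, when the letters
  \<open>y\<close> and \<open>z\<close> have been read. Then \<open>y d' = d z\<close>, and these
  products are among the finitely many pairs of \<open>S0\<close>. Following \<phi> along the pair
  relates the composites of \<open>u\<close> and \<open>v\<close>; comparison with words of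
  \<open>L\<close> then handles arbitrary words over \<open>X\<close>.\<close>

lemma automatic_partial_homs_extend:
  assumes "automatic G"
  shows "partial_homs_extend G"
proof -
  obtain X L where X: "finite X" "X \<subseteq> carrier G" and L: "L \<subseteq> lists X"
    and onto: "word_value G ` L = carrier G"
    and eq_rec: "fa_recognizable 2 X
      {[u, v] | u v. u \<in> L \<and> v \<in> L \<and> word_value G u = word_value G v}"
    and mult_rec: "\<And>x. x \<in> X \<Longrightarrow> fa_recognizable 2 X
      {[u, v] | u v. u \<in> L \<and> v \<in> L \<and> word_value G u = word_value G (v @ [x])}"
    using assms by (auto simp: automatic_def finite_generating_set_def)
  have lists_X: "w \<in> lists (carrier G)" "take k w \<in> lists (carrier G)" if "w \<in> lists X" for w k
    using that X(2) set_take_subset[of k w] by auto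
  define Q where "Q c u v \<longleftrightarrow> u \<in> L \<and> v \<in> L \<and> word_value G u = word_value G v \<otimes> c" for c u v
  define D where "D = (\<Union>c \<in> insert \<one> X.
    {inv (word_value G (take k u)) \<otimes> word_value G (take k v) | u v k. Q c u v})"
  have Q_rec: "fa_recognizable 2 X {[u, v] | u v. Q c u v}" if "c \<in> insert \<one> X" for c
  proof (cases "c = \<one>")
    case True
    have "{[u, v] | u v. Q c u v} = {[u, v] | u v. u \<in> L \<and> v \<in> L \<and> word_value G u = word_value G v}"
      using L lists_X True unfolding Q_def by (metis (no_types, lifting) r_one subsetD word_value_closed)
    then show ?thesis
      using eq_rec by simp
  next
    case False
    then have c: "c \<in> X"
      using that by simp
    have "word_value G (v @ [c]) = word_value G v \<otimes> c" if "v \<in> L" for v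
    proof -
      have "v \<in> lists (carrier G)"
        using that L lists_X(1) by blast
      then show ?thesis
        using c X(2) by (subst word_value_append) auto
    qed
    then have "{[u, v] | u v. Q c u v} =
        {[u, v] | u v. u \<in> L \<and> v \<in> L \<and> word_value G u = word_value G (v @ [c])}"
      unfolding Q_def by (metis (no_types, lifting))
    then show ?thesis
      using mult_rec[OF c] by simp
  qed
  have Q_lists: "u \<in> lists X" "v \<in> lists X" "word_value G u = word_value G v \<otimes> c" if "Q c u v" for c u v
    using that L by (auto simp: Q_def)
  have "finite {inv (word_value G (take k u)) \<otimes> word_value G (take k v) | u v k. Q c u v}"
    if c: "c \<in> insert \<one> X" for c
  proof (rule finite_fellow_traveller_differences[OF Q_rec[OF c] X(2)])
    show "c \<in> carrier G"
      using c X(2) by auto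
  qed (use Q_lists in blast)
  then have "finite D"
    unfolding D_def using X(1) by (intro finite_UN_I) simp_all
  have "D \<subseteq> carrier G"
    using Q_lists(1,2) lists_X(2) by (auto simp: D_def simp del: in_lists_conv_set)
  \<comment> \<open>The empty word may be missing from \<open>L\<close>; \<open>u0\<close> replaces
    it at the start of the induction over words.\<close>
  obtain u0 where u0: "u0 \<in> L" "word_value G u0 = \<one>"
    using onto by (metis imageE one_closed)
  define S0 where "S0 = insert \<one> X \<times> D \<union> D \<times> insert \<one> X \<union> word_steps G u0"
  show ?thesis
  proof (rule partial_homs_extendI)
    show "word_value G ` lists X = carrier G"
      using onto L lists_X(1) word_value_closed by (metis image_mono image_subsetI subset_antisym)
    show "finite S0"
      using X(1) \<open>finite D\<close> by (simp add: S0_def)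
    show "S0 \<subseteq> carrier G \<times> carrier G"
      using X(2) \<open>D \<subseteq> carrier G\<close> word_steps_subset[of u0] u0(1) L lists_X(1)
      unfolding S0_def by blast
  next
    fix \<phi> :: "'a \<Rightarrow> int \<Rightarrow> int" and w1 w2
    assume \<phi>: "\<phi> \<one> = id" "\<forall>(x, y) \<in> S0. \<phi> (x \<otimes> y) = \<phi> x \<circ> \<phi> y"
      and w12: "w1 \<in> lists X" "w2 \<in> lists X" "word_value G w1 = word_value G w2"
    define \<psi> where "\<psi> = foldr \<phi>"
    have \<psi>_append: "\<psi> (u @ v) = \<psi> u \<circ> \<psi> v" for u v
      by (simp add: \<psi>_def fun_eq_iff)
    have travel: "\<psi> (take k v) = \<psi> (take k u) \<circ> \<phi> (inv (word_value G (take k u)) \<otimes> word_value G (take k v))"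
      if Q: "Q c u v" and c: "c \<in> insert \<one> X" for c u v k
    proof (induction k)
      case 0
      show ?case
        using \<phi>(1) by (simp add: \<psi>_def)
    next
      case (Suc k)
      have D: "inv (word_value G (take j u)) \<otimes> word_value G (take j v) \<in> D" for j
        using Q c unfolding D_def by blast
      \<comment> \<open>Beyond its end a word contributes the letter \<one>, so both words advance
        in lockstep although their lengths may differ.\<close>
      have step: "\<exists>y \<in> insert \<one> X. \<psi> (take (Suc k) w) = \<psi> (take k w) \<circ> \<phi> y \<and>
          word_value G (take (Suc k) w) = word_value G (take k w) \<otimes> y" if "w \<in> lists X" for w
      proof (cases "k < length w")
        case True
        have "w ! k \<in> X"
          using True that by auto
        then have "word_value G (take k w @ [w ! k]) = word_value G (take k w) \<otimes> w ! k"
          using lists_X(2)[OF that] X(2) by (subst word_value_append) auto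
        moreover have "\<psi> (take k w @ [w ! k]) = \<psi> (take k w) \<circ> \<phi> (w ! k)"
          unfolding \<psi>_append by (simp add: \<psi>_def)
        ultimately show ?thesis
          using \<open>w ! k \<in> X\<close> True by (auto simp: take_Suc_conv_app_nth)
      next
        case False
        then show ?thesis
          using \<phi>(1) lists_X[OF that] by auto
      qed
      define U where "U = word_value G (take k u)"
      define V where "V = word_value G (take k v)"
      obtain y where y: "y \<in> insert \<one> X" "\<psi> (take (Suc k) u) = \<psi> (take k u) \<circ> \<phi> y"
        "word_value G (take (Suc k) u) = U \<otimes> y"
        using step[OF Q_lists(1)[OF Q]] by (auto simp: U_def)
      obtain z where z: "z \<in> insert \<one> X" "\<psi> (take (Suc k) v) = \<psi> (take k v) \<circ> \<phi> z"
        "word_value G (take (Suc k) v) = V \<otimes> z"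
        using step[OF Q_lists(2)[OF Q]] by (auto simp: V_def)
      have carrier: "U \<in> carrier G" "V \<in> carrier G" "y \<in> carrier G" "z \<in> carrier G"
        using Q_lists[OF Q] lists_X(2) X(2) y(1) z(1) by (auto simp: U_def V_def)
      let ?d = "inv U \<otimes> V" and ?d' = "inv (U \<otimes> y) \<otimes> (V \<otimes> z)"
      \<comment> \<open>Both sides equal \<open>inv U \<otimes> V \<otimes> z\<close>: the square
        spanned by one step of each word closes.\<close>
      have d_eq: "y \<otimes> ?d' = ?d \<otimes> z"
        using carrier by (simp add: inv_mult_group m_assoc[symmetric])
      have "?d \<in> D" "?d' \<in> D"
        using D[of k] D[of "Suc k"] y(3) z(3) by (auto simp: U_def V_def)
      then have \<phi>_d: "\<phi> (y \<otimes> ?d') = \<phi> y \<circ> \<phi> ?d'" "\<phi> (?d \<otimes> z) = \<phi> ?d \<circ> \<phi> z"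
        using \<phi>(2) y(1) z(1) unfolding S0_def by blast+
      have "\<psi> (take (Suc k) v) = \<psi> (take k u) \<circ> (\<phi> ?d \<circ> \<phi> z)"
        unfolding z(2) Suc.IH U_def V_def by (simp add: comp_assoc)
      also have "\<dots> = \<psi> (take (Suc k) u) \<circ> \<phi> ?d'"
        using \<phi>_d d_eq y(2) by (metis comp_assoc)
      finally show ?case
        using y(3) z(3) by simp
    qed
    have \<psi>_mult: "\<psi> u = \<psi> v \<circ> \<phi> c" if Q: "Q c u v" and c: "c \<in> insert \<one> X" for c u v
    proof -
      \<comment> \<open>At this time both prefixes are the full words, so the difference is the
        inverse of \<open>c\<close> and still belongs to \<open>D\<close>.\<close>
      let ?k = "max (length u) (length v)"
      have carrier: "word_value G u \<in> carrier G" "word_value G v \<in> carrier G" "c \<in> carrier G"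
        using lists_X(1)[OF Q_lists(1)[OF Q]] lists_X(1)[OF Q_lists(2)[OF Q]] c X(2) by auto
      let ?d = "inv (word_value G u) \<otimes> word_value G v"
      have "?d = inv (word_value G (take ?k u)) \<otimes> word_value G (take ?k v)"
        by simp
      then have "?d \<in> D"
        using Q c unfolding D_def by blast
      moreover have "?d \<otimes> c = \<one>"
        using carrier Q_lists(3)[OF Q] by (metis inv_closed l_inv m_assoc m_closed)
      moreover from \<open>?d \<in> D\<close> have "\<phi> (?d \<otimes> c) = \<phi> ?d \<circ> \<phi> c"
        using \<phi>(2) c unfolding S0_def by blast
      ultimately have "\<phi> ?d \<circ> \<phi> c = id"
        using \<phi>(1) by simp
      moreover have "\<psi> v = \<psi> u \<circ> \<phi> ?d"
        using travel[OF Q c, of ?k] by simp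
      ultimately show ?thesis
        by (metis comp_assoc comp_id)
    qed
    have \<psi>_u0: "\<psi> u0 = id"
      using foldr_eq_word_value[of \<phi> G u0] \<phi> u0(2) by (auto simp: \<psi>_def S0_def)
    \<comment> \<open>Induction at the right end: \<open>v\<close> in \<open>L\<close> stands for
      \<open>w\<close>, \<open>u\<close> for \<open>w\<close> followed by \<open>x\<close>, and the
      multiplier relation of \<open>x\<close> links the two.\<close>
    have \<psi>_L: "\<psi> u = \<psi> w" if "w \<in> lists X" "u \<in> L" "word_value G u = word_value G w" for w u
      using that
    proof (induction w arbitrary: u rule: rev_induct)
      case Nil
      then have "Q \<one> u u0"
        using u0 by (simp add: Q_def)
      then show ?case
        using \<psi>_mult[of \<one> u u0] \<psi>_u0 \<phi>(1) by (simp add: \<psi>_def)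
    next
      case (snoc x w)
      have w: "w \<in> lists X" "x \<in> X"
        using snoc.prems(1) by auto
      obtain v where v: "v \<in> L" "word_value G v = word_value G w"
        using onto word_value_closed[OF lists_X(1)[OF w(1)]] by (metis imageE)
      have "word_value G (w @ [x]) = word_value G w \<otimes> x"
        using lists_X(1)[OF w(1)] w(2) X(2) by (subst word_value_append) auto
      then have "Q x u v"
        using snoc.prems v by (simp add: Q_def)
      then have "\<psi> u = \<psi> w \<circ> \<phi> x"
        using \<psi>_mult[of x u v] w(2) snoc.IH[OF w(1) v] by simp
      then show ?case
        unfolding \<psi>_append by (simp add: \<psi>_def)
    qed
    obtain u where "u \<in> L" "word_value G u = word_value G w1"
      using onto word_value_closed[OF lists_X(1)[OF w12(1)]] by (metis imageE)
    then show "foldr \<phi> w1 = foldr \<phi> w2"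
      using \<psi>_L w12 unfolding \<psi>_def by metis
  qed (fact X(2))
qed

end

subsection \<open>The lamplighter group\<close>

text \<open>The restricted wreath product of the group of order two by the integers: disequality is
  addition modulo 2, and the second configuration is shifted because it is read from position
  \<open>k\<close>.\<close>

definition lamplighter :: "((int \<Rightarrow> bool) \<times> int) monoid" where
  "lamplighter =
     \<lparr>carrier = {(f, k). finite {i. f i}},
      monoid.mult = (\<lambda>(f, k) (g, l). (\<lambda>i. f i \<noteq> g (i - k), k + l)),
      one = (\<lambda>i. False, 0)\<rparr>"

lemma lamplighter_simps [simp]:
  "(f, k) \<in> carrier lamplighter \<longleftrightarrow> finite {i. f i}"
  "(f, k) \<otimes>\<^bsub>lamplighter\<^esub> (g, l) = (\<lambda>i. f i \<noteq> g (i - k), k + l)"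
  "\<one>\<^bsub>lamplighter\<^esub> = (\<lambda>i. False, 0)"
  by (auto simp: lamplighter_def)

definition lamp_gen :: "(int \<Rightarrow> bool) \<times> int" where
  "lamp_gen = (\<lambda>i. i = 0, 0)"

definition move_gen :: "(int \<Rightarrow> bool) \<times> int" where
  "move_gen = (\<lambda>i. False, 1)"

lemma finite_support_shift: "finite {i. f i} \<Longrightarrow> finite {i. f (i - k :: int)}"
  using finite_vimageI[of "{i. f i}" "\<lambda>i. i - k"] by (simp add: vimage_def inj_on_def)

lemma finite_support_xor: "finite {i. f i} \<Longrightarrow> finite {i. g i} \<Longrightarrow> finite {i. f i \<noteq> g i}"
  by (rule finite_subset[of _ "{i. f i} \<union> {i. g i}"]) auto

lemma group_lamplighter: "group lamplighter"
proof (rule groupI)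
  fix x y assume "x \<in> carrier lamplighter" "y \<in> carrier lamplighter"
  moreover obtain f k g l where "x = (f, k)" "y = (g, l)"
    by (cases x; cases y)
  ultimately show "x \<otimes>\<^bsub>lamplighter\<^esub> y \<in> carrier lamplighter"
    using finite_support_xor[of f "\<lambda>i. g (i - k)"] finite_support_shift[of g k] by simp
next
  fix x y z
  show "x \<otimes>\<^bsub>lamplighter\<^esub> y \<otimes>\<^bsub>lamplighter\<^esub> z = x \<otimes>\<^bsub>lamplighter\<^esub> (y \<otimes>\<^bsub>lamplighter\<^esub> z)"
    by (cases x; cases y; cases z) (auto simp: fun_eq_iff algebra_simps)
next
  fix x assume "x \<in> carrier lamplighter"
  then obtain f k where "x = (f, k)" "finite {i. f i}"
    by (cases x) simp
  then show "\<exists>y \<in> carrier lamplighter. y \<otimes>\<^bsub>lamplighter\<^esub> x = \<one>\<^bsub>lamplighter\<^esub>"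
    using finite_support_shift[of f "- k"] by (intro bexI[of _ "(\<lambda>i. f (i + k), - k)"]) auto
next
  fix x show "\<one>\<^bsub>lamplighter\<^esub> \<otimes>\<^bsub>lamplighter\<^esub> x = x"
    by (cases x) simp
qed simp

text \<open>The lamps in \<open>f\<close> act by swapping \<open>i\<close> with \<open>i + N\<close>; these swaps commute as long as all
  lamps lie in an interval of length less than \<open>N\<close>.\<close>

definition lamp_swaps :: "int \<Rightarrow> (int \<Rightarrow> bool) \<Rightarrow> int \<Rightarrow> int" where
  "lamp_swaps N f y = (if f y then y + N else if f (y - N) then y - N else y)"

text \<open>Two lit lamps, from either configuration, are never at distance exactly
  \<open>N\<close>. Hence distinct swaps have disjoint supports and commute, and a lamp lit in both
  configurations is swapped twice, which cancels.\<close>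

lemma lamp_swaps_comp:
  assumes "\<And>i. f i \<Longrightarrow> \<bar>i\<bar> \<le> M" "\<And>i. g i \<Longrightarrow> \<bar>i\<bar> \<le> M" "2 * M < N"
  shows "lamp_swaps N (\<lambda>i. f i \<noteq> g i) y = lamp_swaps N f (lamp_swaps N g y)"
proof -
  have apart: "\<not> (h i \<and> h' (i + N))" if "\<And>i. h i \<Longrightarrow> \<bar>i\<bar> \<le> M" "\<And>i. h' i \<Longrightarrow> \<bar>i\<bar> \<le> M"
    for h h' i
    using that(1)[of i] that(2)[of "i + N"] assms(3) by auto
  show ?thesis
    \<comment> \<open>Two successive swaps starting from \<open>y\<close> inspect only the lamps at
      \<open>y + N\<close>, \<open>y\<close>, \<open>y - N\<close> and
      \<open>y - 2 * N\<close>.\<close>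
    using apart[of f f y] apart[of f g y] apart[of g f y] apart[of g g y]
      apart[of f f "y - N"] apart[of f g "y - N"] apart[of g f "y - N"] apart[of g g "y - N"]
      apart[of f f "y - 2 * N"] apart[of g f "y - 2 * N"] apart[of f g "y - 2 * N"] assms
    unfolding lamp_swaps_def by (auto simp: algebra_simps)
qed

lemma lamplighter_not_partial_homs_extend: "\<not> partial_homs_extend lamplighter"
proof
  assume P: "partial_homs_extend lamplighter"
  \<comment> \<open>The inverse move belongs to \<open>T\<close> so that the extension is known
    there directly, without a detour through inverses of self-maps.\<close>
  have "{lamp_gen, move_gen, (\<lambda>i. False, -1)} \<subseteq> carrier lamplighter"
    by (simp add: lamp_gen_def move_gen_def)
  with P[unfolded partial_homs_extend_def, rule_format, OF conjI, OF _ this]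
  obtain S where S: "finite S" "S \<subseteq> carrier lamplighter \<times> carrier lamplighter"
    and ext: "\<And>\<phi> :: (int \<Rightarrow> bool) \<times> int \<Rightarrow> int \<Rightarrow> int.
      \<phi> \<one>\<^bsub>lamplighter\<^esub> = id \<and> (\<forall>(x, y) \<in> S. \<phi> (x \<otimes>\<^bsub>lamplighter\<^esub> y) = \<phi> x \<circ> \<phi> y) \<longrightarrow>
      (\<exists>\<Psi>. (\<forall>x \<in> carrier lamplighter. \<forall>y \<in> carrier lamplighter. \<Psi> (x \<otimes>\<^bsub>lamplighter\<^esub> y) = \<Psi> x \<circ> \<Psi> y) \<and>
        (\<forall>x \<in> {lamp_gen, move_gen, (\<lambda>i. False, -1)}. \<Psi> x = \<phi> x))"
    by auto
  define lamps where "lamps = (\<Union>((f, k), (g, l)) \<in> S. {i. f i} \<union> {i. g (i - k)} \<union> {i. g i})"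
  have "finite lamps"
    unfolding lamps_def using S by (intro finite_UN_I) (auto simp: finite_support_shift)
  define M where "M = Max (insert 0 (abs ` lamps))"
  \<comment> \<open>The least integer exceeding \<open>2 * M\<close>, the bound under which the
    swaps compose.\<close>
  define N where "N = 2 * M + 1"
  have M: "\<bar>i\<bar> \<le> M" if "i \<in> lamps" for i
    using that \<open>finite lamps\<close> by (auto simp: M_def)
  have "0 \<le> M"
    using \<open>finite lamps\<close> by (simp add: M_def)
  define \<phi> where "\<phi> = (\<lambda>(f, k) x. lamp_swaps N f (x + k))"
  have "\<phi> \<one>\<^bsub>lamplighter\<^esub> = id"
    by (simp add: \<phi>_def lamp_swaps_def fun_eq_iff)
  moreover have "\<phi> (x \<otimes>\<^bsub>lamplighter\<^esub> y) = \<phi> x \<circ> \<phi> y" if "(x, y) \<in> S" for x y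
  proof -
    obtain f k g l where xy: "x = (f, k)" "y = (g, l)"
      by (cases x; cases y)
    have "lamp_swaps N (\<lambda>i. f i \<noteq> g (i - k)) (z + l + k) = lamp_swaps N f (lamp_swaps N g (z + l) + k)" for z
    proof -
      have "lamp_swaps N (\<lambda>i. f i \<noteq> g (i - k)) (z + l + k) =
          lamp_swaps N f (lamp_swaps N (\<lambda>i. g (i - k)) (z + l + k))"
      proof (rule lamp_swaps_comp)
        show "\<bar>i\<bar> \<le> M" if "f i" for i
          using that \<open>(x, y) \<in> S\<close> xy by (intro M) (force simp: lamps_def)
        show "\<bar>i\<bar> \<le> M" if "g (i - k)" for i
          using that \<open>(x, y) \<in> S\<close> xy by (intro M) (force simp: lamps_def)
      qed (simp add: N_def)
      \<comment> \<open>Conjugating by a translation moves the swaps to the shifted lamps, matching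
        the shift in the group product.\<close>
      also have "lamp_swaps N (\<lambda>i. g (i - k)) (z + l + k) = lamp_swaps N g (z + l) + k"
        by (auto simp: lamp_swaps_def algebra_simps)
      finally show ?thesis .
    qed
    then show ?thesis
      by (simp add: xy \<phi>_def fun_eq_iff algebra_simps)
  qed
  ultimately have "\<phi> \<one>\<^bsub>lamplighter\<^esub> = id \<and> (\<forall>(x, y) \<in> S. \<phi> (x \<otimes>\<^bsub>lamplighter\<^esub> y) = \<phi> x \<circ> \<phi> y)"
    by blast
  from ext[rule_format, OF this] obtain \<Psi> where
    \<Psi>_mult: "\<forall>x \<in> carrier lamplighter. \<forall>y \<in> carrier lamplighter. \<Psi> (x \<otimes>\<^bsub>lamplighter\<^esub> y) = \<Psi> x \<circ> \<Psi> y"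
    and gens: "\<forall>x \<in> {lamp_gen, move_gen, (\<lambda>i. False, -1)}. \<Psi> x = \<phi> x"
    by (elim exE conjE)
  have \<Psi>: "\<Psi> (x \<otimes>\<^bsub>lamplighter\<^esub> y) = \<Psi> x \<circ> \<Psi> y"
    if "x \<in> carrier lamplighter" "y \<in> carrier lamplighter" for x y
    using \<Psi>_mult that by blast
  have \<Psi>_gen: "\<Psi> lamp_gen = \<phi> lamp_gen" "\<Psi> move_gen = \<phi> move_gen"
    "\<Psi> (\<lambda>i. False, -1) = \<phi> (\<lambda>i. False, -1)"
    using gens by simp_all
  \<comment> \<open>The extension is prescribed at unit moves only, so the translation by
    \<open>N\<close> is built up from them. Counting starts at one since the value at the identity
    is not among the prescribed ones.\<close>
  have move: "\<Psi> (\<lambda>i. False, int (Suc n)) x = x + int (Suc n) \<and>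
      \<Psi> (\<lambda>i. False, - int (Suc n)) x = x - int (Suc n)" for n x
  proof (induction n arbitrary: x)
    case 0
    show ?case
      using \<Psi>_gen(2,3) by (simp add: move_gen_def \<phi>_def lamp_swaps_def)
  next
    case (Suc n)
    have "\<Psi> ((\<lambda>i. False, int (Suc n)) \<otimes>\<^bsub>lamplighter\<^esub> move_gen) x = x + int (Suc (Suc n))"
      using \<Psi>[of "(\<lambda>i. False, int (Suc n))" move_gen] Suc[of "x + 1"] \<Psi>_gen(2)
      by (simp add: move_gen_def \<phi>_def lamp_swaps_def)
    moreover have "\<Psi> ((\<lambda>i. False, - int (Suc n)) \<otimes>\<^bsub>lamplighter\<^esub> (\<lambda>i. False, -1)) x = x - int (Suc (Suc n))"
      using \<Psi>[of "(\<lambda>i. False, - int (Suc n))" "(\<lambda>i. False, -1)"] Suc[of "x - 1"] \<Psi>_gen(3)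
      by (simp add: \<phi>_def lamp_swaps_def)
    moreover have "(\<lambda>i. False, int (Suc n)) \<otimes>\<^bsub>lamplighter\<^esub> move_gen = (\<lambda>i. False, int (Suc (Suc n)))"
      "(\<lambda>i. False, - int (Suc n)) \<otimes>\<^bsub>lamplighter\<^esub> (\<lambda>i. False, -1) = (\<lambda>i. False, - int (Suc (Suc n)))"
      by (simp_all add: move_gen_def)
    ultimately show ?case
      by metis
  qed
  define t where "t = (\<lambda>i :: int. False, N)"
  define t' where "t' = (\<lambda>i :: int. False, - N)"
  have \<Psi>_t: "\<Psi> t x = x + N" "\<Psi> t' x = x - N" for x
    using move[of "nat (2 * M)" x] \<open>0 \<le> M\<close> by (simp_all add: t_def t'_def N_def algebra_simps)
  have carrier: "lamp_gen \<in> carrier lamplighter" "t \<in> carrier lamplighter" "t' \<in> carrier lamplighter"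
    by (simp_all add: lamp_gen_def t_def t'_def)
  interpret group lamplighter
    by (rule group_lamplighter)
  \<comment> \<open>The lamp at \<open>N\<close>, as a conjugate of the lamp at 0. Its image swaps
    \<open>N\<close> with \<open>2 * N\<close>.\<close>
  define b where "b = t \<otimes>\<^bsub>lamplighter\<^esub> lamp_gen \<otimes>\<^bsub>lamplighter\<^esub> t'"
  have "b \<in> carrier lamplighter"
    using carrier by (simp add: b_def del: lamplighter_simps)
  moreover have "\<Psi> b x = \<Psi> lamp_gen (x - N) + N" for x
    using carrier by (simp add: b_def \<Psi> \<Psi>_t del: lamplighter_simps)
  moreover have "lamp_gen \<otimes>\<^bsub>lamplighter\<^esub> b = b \<otimes>\<^bsub>lamplighter\<^esub> lamp_gen"
    by (auto simp: b_def lamp_gen_def t_def t'_def)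
  ultimately have "\<Psi> lamp_gen (\<Psi> lamp_gen (x - N) + N) = \<Psi> lamp_gen (\<Psi> lamp_gen x - N) + N" for x
    using \<Psi>[of lamp_gen b] \<Psi>[of b lamp_gen] carrier(1) by (metis comp_apply)
  \<comment> \<open>Swapping \<open>N\<close> and \<open>2 * N\<close> before 0 and \<open>N\<close>
    sends 0 to \<open>N\<close>; the other order sends it to \<open>2 * N\<close>. These differ
    because \<open>N\<close> is positive.\<close>
  from this[of 0] show False
    using \<open>0 \<le> M\<close> \<Psi>_gen(1) by (simp add: \<phi>_def lamp_gen_def lamp_swaps_def N_def split: if_splits)
qed

subsection \<open>Closure properties of regular languages\<close>

text \<open>The hypothesis on transitions is a local bisimulation along \<open>h\<close>. It covers
  both renaming states and embedding an automaton as a component of a larger one.\<close>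

lemma nfa_path_rename:
  assumes T: "\<And>p a r. p \<in> S \<Longrightarrow>
      (h p, a, r) \<in> nfa_trans M' \<longleftrightarrow> (\<exists>q. (p, a, q) \<in> nfa_trans M \<and> q \<in> S \<and> r = h q)"
    and closed: "\<And>p a q. p \<in> S \<Longrightarrow> (p, a, q) \<in> nfa_trans M \<Longrightarrow> q \<in> S"
    and "p \<in> S"
  shows "nfa_path M' (h p) w r \<longleftrightarrow> (\<exists>q. nfa_path M p w q \<and> r = h q)"
  using \<open>p \<in> S\<close>
proof (induction w arbitrary: p)
  case (Cons a w)
  have "nfa_path M' (h p) (a # w) r \<longleftrightarrow>
      (\<exists>q. (p, a, q) \<in> nfa_trans M \<and> q \<in> S \<and> nfa_path M' (h q) w r)"
    using T[OF Cons.prems] by auto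
  also have "\<dots> \<longleftrightarrow> (\<exists>q. (p, a, q) \<in> nfa_trans M \<and> (\<exists>q'. nfa_path M q w q' \<and> r = h q'))"
    using Cons.IH closed[OF Cons.prems] by blast
  finally show ?case
    by auto
qed auto

text \<open>Frees later constructions from natural-number states, so that sums and options may serve
  as state types.\<close>

lemma regular_language_nfa_lang:
  assumes "nfa_over \<Sigma> (M :: ('s, 'a) nfa)"
  shows "regular_language \<Sigma> (nfa_lang M)"
proof -
  let ?S = "nfa_states M"
  have "finite ?S"
    using assms by (simp add: nfa_over_def)
  then obtain h :: "'s \<Rightarrow> nat" where h: "inj_on h ?S"
    using finite_imp_inj_to_nat_seg by metis
  define M' where "M' = \<lparr>nfa_states = h ` ?S, nfa_init = h ` nfa_init M,
    nfa_trans = {(h p, a, h q) | p a q. (p, a, q) \<in> nfa_trans M}, nfa_final = h ` nfa_final M\<rparr>"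
  have M: "nfa_init M \<subseteq> ?S" "nfa_final M \<subseteq> ?S" "nfa_trans M \<subseteq> ?S \<times> \<Sigma> \<times> ?S" "finite \<Sigma>"
    using assms by (auto simp: nfa_over_def)
  have T: "(h p, a, r) \<in> nfa_trans M' \<longleftrightarrow> (\<exists>q. (p, a, q) \<in> nfa_trans M \<and> q \<in> ?S \<and> r = h q)"
    if "p \<in> ?S" for p a r
    using M(3) that h by (auto simp: M'_def dest: inj_onD)
  have path: "nfa_path M' (h p) w r \<longleftrightarrow> (\<exists>q. nfa_path M p w q \<and> r = h q)" if "p \<in> ?S" for p w r
    by (rule nfa_path_rename[where S = ?S]) (erule T, use M(3) that in auto)
  have state: "q \<in> ?S" if "nfa_path M p w q" "p \<in> ?S" for p w q
    using that by (induction w arbitrary: p) (use M(3) in auto)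
  have "w \<in> nfa_lang M' \<longleftrightarrow> w \<in> nfa_lang M" for w
  proof
    assume "w \<in> nfa_lang M'"
    then obtain p f where p: "p \<in> nfa_init M" "f \<in> nfa_final M" "nfa_path M' (h p) w (h f)"
      by (auto simp: nfa_lang_def M'_def)
    then obtain q where "nfa_path M p w q" "h f = h q"
      using path M(1) by blast
    then show "w \<in> nfa_lang M"
      using p(1,2) M(1,2) state inj_onD[OF h] by (metis (mono_tags, lifting) mem_Collect_eq nfa_lang_def subsetD)
  next
    assume "w \<in> nfa_lang M"
    then obtain p f where p: "p \<in> nfa_init M" "f \<in> nfa_final M" "nfa_path M p w f"
      by (auto simp: nfa_lang_def)
    then have "nfa_path M' (h p) w (h f)"
      using path M(1) by blast
    then show "w \<in> nfa_lang M'"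
      using p(1,2) by (auto simp: nfa_lang_def M'_def)
  qed
  moreover have "nfa_over \<Sigma> M'"
    using M \<open>finite ?S\<close> by (auto simp: nfa_over_def M'_def)
  ultimately show ?thesis
    unfolding regular_language_def by blast
qed

text \<open>The base of all later languages, which grow from the right by prepending a letter or
  arbitrary words over a letter set, and by unions.\<close>

lemma regular_Nil:
  assumes "finite (\<Sigma> :: 'a set)"
  shows "regular_language \<Sigma> {[]}"
proof -
  define M :: "(unit, 'a) nfa" where
    "M = \<lparr>nfa_states = {()}, nfa_init = {()}, nfa_trans = {}, nfa_final = {()}\<rparr>"
  have "nfa_path M p w q \<longleftrightarrow> w = []" for p w q
    by (cases w) (auto simp: M_def)
  then have "nfa_lang M = {[]}"
    by (auto simp: nfa_lang_def M_def)
  moreover have "nfa_over \<Sigma> M"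
    using assms by (simp add: nfa_over_def M_def)
  ultimately show ?thesis
    using regular_language_nfa_lang by metis
qed

lemma regular_Un:
  assumes "regular_language \<Sigma> K" "regular_language \<Sigma> L"
  shows "regular_language \<Sigma> (K \<union> L)"
proof -
  obtain M M' :: "(nat, 'a) nfa" where M: "nfa_over \<Sigma> M" "nfa_lang M = K"
    and M': "nfa_over \<Sigma> M'" "nfa_lang M' = L"
    using assms by (auto simp: regular_language_def)
  define U where "U = \<lparr>nfa_states = nfa_states M <+> nfa_states M', nfa_init = nfa_init M <+> nfa_init M',
    nfa_trans = {(Inl p, a, Inl q) | p a q. (p, a, q) \<in> nfa_trans M} \<union>
      {(Inr p, a, Inr q) | p a q. (p, a, q) \<in> nfa_trans M'},
    nfa_final = nfa_final M <+> nfa_final M'\<rparr>"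
  have Inl: "nfa_path U (Inl p) w r \<longleftrightarrow> (\<exists>q. nfa_path M p w q \<and> r = Inl q)" for p w r
    by (rule nfa_path_rename[where S = UNIV]) (auto simp: U_def)
  have Inr: "nfa_path U (Inr p) w r \<longleftrightarrow> (\<exists>q. nfa_path M' p w q \<and> r = Inr q)" for p w r
    by (rule nfa_path_rename[where S = UNIV]) (auto simp: U_def)
  have init: "nfa_init U = Inl ` nfa_init M \<union> Inr ` nfa_init M'"
    and final: "nfa_final U = Inl ` nfa_final M \<union> Inr ` nfa_final M'"
    by (auto simp: U_def)
  have "nfa_lang U = nfa_lang M \<union> nfa_lang M'"
  proof (rule Set.set_eqI)
    fix w
    have "(\<exists>r \<in> nfa_final U. nfa_path U (Inl p) w r) \<longleftrightarrow> (\<exists>q \<in> nfa_final M. nfa_path M p w q)" for p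
      unfolding Inl final by blast
    moreover have "(\<exists>r \<in> nfa_final U. nfa_path U (Inr p) w r) \<longleftrightarrow> (\<exists>q \<in> nfa_final M'. nfa_path M' p w q)" for p
      unfolding Inr final by blast
    ultimately show "w \<in> nfa_lang U \<longleftrightarrow> w \<in> nfa_lang M \<union> nfa_lang M'"
      unfolding nfa_lang_def init by (simp add: bex_Un)
  qed
  moreover have "nfa_over \<Sigma> U"
    using M(1) M'(1) by (auto simp: nfa_over_def U_def)
  ultimately show ?thesis
    using regular_language_nfa_lang M(2) M'(2) by metis
qed

lemma regular_prepend_letter:
  assumes "regular_language \<Sigma> L" "K \<subseteq> \<Sigma>"
  shows "regular_language \<Sigma> {k # v | k v. k \<in> K \<and> v \<in> L}"
proof -
  obtain M :: "(nat, 'a) nfa" where M: "nfa_over \<Sigma> M" "nfa_lang M = L"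
    using assms(1) by (auto simp: regular_language_def)
  define U where "U = \<lparr>nfa_states = insert None (Some ` nfa_states M), nfa_init = {None},
    nfa_trans = {(Some p, a, Some q) | p a q. (p, a, q) \<in> nfa_trans M} \<union>
      {(None, k, Some q) | k q. k \<in> K \<and> q \<in> nfa_init M},
    nfa_final = Some ` nfa_final M\<rparr>"
  have path: "nfa_path U (Some p) w r \<longleftrightarrow> (\<exists>q. nfa_path M p w q \<and> r = Some q)" for p w r
    by (rule nfa_path_rename[where S = UNIV]) (auto simp: U_def)
  have None: "(None, k, r) \<in> nfa_trans U \<longleftrightarrow> k \<in> K \<and> (\<exists>q \<in> nfa_init M. r = Some q)" for k r
    by (auto simp: U_def)
  have final: "nfa_init U = {None}" "nfa_final U = Some ` nfa_final M"
    by (simp_all add: U_def)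
  have "w \<in> nfa_lang U \<longleftrightarrow> w \<in> {k # v | k v. k \<in> K \<and> v \<in> nfa_lang M}" for w
  proof (cases w)
    case (Cons k v)
    have "(\<exists>r \<in> nfa_final U. nfa_path U (Some p) v r) \<longleftrightarrow> (\<exists>q \<in> nfa_final M. nfa_path M p v q)" for p
      unfolding path final by blast
    moreover have "nfa_path U None (k # v) r \<longleftrightarrow> k \<in> K \<and> (\<exists>q \<in> nfa_init M. nfa_path U (Some q) v r)" for r
      using None by auto
    ultimately have "(\<exists>r \<in> nfa_final U. nfa_path U None (k # v) r) \<longleftrightarrow>
        k \<in> K \<and> (\<exists>p \<in> nfa_init M. \<exists>q \<in> nfa_final M. nfa_path M p v q)"
      by blast
    then show ?thesis
      unfolding nfa_lang_def final(1) Cons by auto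
  qed (auto simp: nfa_lang_def final)
  then have "nfa_lang U = {k # v | k v. k \<in> K \<and> v \<in> nfa_lang M}"
    by blast
  moreover have "nfa_over \<Sigma> U"
    using M(1) assms(2) by (auto simp: nfa_over_def U_def)
  ultimately show ?thesis
    using regular_language_nfa_lang M(2) by metis
qed

lemma regular_prepend_lists:
  assumes "regular_language \<Sigma> L" "K \<subseteq> \<Sigma>"
  shows "regular_language \<Sigma> {u @ v | u v. u \<in> lists K \<and> v \<in> L}"
proof -
  obtain M :: "(nat, 'a) nfa" where M: "nfa_over \<Sigma> M" "nfa_lang M = L"
    using assms(1) by (auto simp: regular_language_def)
  \<comment> \<open>\<open>None\<close> loops over the prefix. Each letter of \<open>K\<close> may
    also lead straight to an initial state of \<open>M\<close>, in place of a silent transition; the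
    initial states of \<open>M\<close> remain initial for the empty prefix.\<close>
  define U where "U = \<lparr>nfa_states = insert None (Some ` nfa_states M),
    nfa_init = insert None (Some ` nfa_init M),
    nfa_trans = {(Some p, a, Some q) | p a q. (p, a, q) \<in> nfa_trans M} \<union>
      {(None, k, r) | k r. k \<in> K \<and> r \<in> insert None (Some ` nfa_init M)},
    nfa_final = Some ` nfa_final M\<rparr>"
  have path: "nfa_path U (Some p) w r \<longleftrightarrow> (\<exists>q. nfa_path M p w q \<and> r = Some q)" for p w r
    by (rule nfa_path_rename[where S = UNIV]) (auto simp: U_def)
  have None: "(None, k, r) \<in> nfa_trans U \<longleftrightarrow> k \<in> K \<and> r \<in> nfa_init U" for k r
    by (auto simp: U_def)
  have final: "nfa_init U = insert None (Some ` nfa_init M)" "nfa_final U = Some ` nfa_final M"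
    by (simp_all add: U_def)
  have base: "w \<in> nfa_lang M \<longleftrightarrow> (\<exists>p \<in> nfa_init M. \<exists>f \<in> nfa_final M. nfa_path U (Some p) w (Some f))" for w
    by (simp add: nfa_lang_def path)
  have split: "w \<in> nfa_lang U \<longleftrightarrow> w \<in> nfa_lang M \<or> (\<exists>f \<in> nfa_final M. nfa_path U None w (Some f))" for w
    unfolding base unfolding nfa_lang_def final by auto
  have from_None: "(\<exists>f \<in> nfa_final M. nfa_path U None (k # w) (Some f)) \<longleftrightarrow> k \<in> K \<and> w \<in> nfa_lang U" for k w
  proof -
    have "nfa_path U None (k # w) r \<longleftrightarrow> k \<in> K \<and> (\<exists>p \<in> nfa_init U. nfa_path U p w r)" for r
      using None by auto
    then show ?thesis
      unfolding nfa_lang_def final(2) by auto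
  qed
  have sound: "\<exists>u v. w = u @ v \<and> u \<in> lists K \<and> v \<in> nfa_lang M" if "w \<in> nfa_lang U" for w
    using that
  proof (induction w)
    case Nil
    then show ?case
      by (auto simp: split)
  next
    case (Cons k w)
    show ?case
    proof (cases "k # w \<in> nfa_lang M")
      case True
      then show ?thesis
        by (metis append_Nil lists.Nil)
    next
      case False
      then have "k \<in> K" "w \<in> nfa_lang U"
        using Cons.prems from_None split by blast+
      with Cons.IH obtain u v where "w = u @ v" "u \<in> lists K" "v \<in> nfa_lang M"
        by blast
      then show ?thesis
        using \<open>k \<in> K\<close> by (metis append_Cons lists.Cons)
    qed
  qed
  have complete: "u @ v \<in> nfa_lang U" if "u \<in> lists K" "v \<in> nfa_lang M" for u v
    using that
  proof (induction u)
    case Nil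
    then show ?case
      by (simp add: split)
  next
    case (Cons k u)
    then have "k \<in> K \<and> u @ v \<in> nfa_lang U"
      by simp
    then show ?case
      using from_None[of k "u @ v"] split by (metis append_Cons)
  qed
  have "nfa_lang U = {u @ v | u v. u \<in> lists K \<and> v \<in> nfa_lang M}"
    using sound complete by blast
  moreover have "nfa_over \<Sigma> U"
    using M(1) assms(2) by (auto simp: nfa_over_def U_def)
  ultimately show ?thesis
    using regular_language_nfa_lang M(2) by metis
qed

subsection \<open>Normal forms on the folded tape\<close>

type_synonym cell = "bool \<times> bool"

abbreviation blank :: cell where
  "blank \<equiv> (False, False)"

text \<open>Trailing blanks beyond the head are the only redundancy of a tape; blanks up to and
  including the head cell must stay, as they record its position.\<close>

definition trimmed :: "cell list \<Rightarrow> bool" where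
  "trimmed s \<longleftrightarrow> (s \<noteq> [] \<longrightarrow> last s \<noteq> blank)"

lemma trimmed_simps [simp]:
  "trimmed []"
  "trimmed (d # s) \<longleftrightarrow> (if s = [] then d \<noteq> blank else trimmed s)"
  "trimmed (s @ [d]) \<longleftrightarrow> d \<noteq> blank"
  by (auto simp: trimmed_def)

text \<open>The default \<open>blank\<close> makes lists that differ in trailing blanks describe the
  same lamps.\<close>

definition cell_at :: "cell list \<Rightarrow> nat \<Rightarrow> cell" where
  "cell_at cs n = (if n < length cs then cs ! n else blank)"

lemma cell_at_append_blank [simp]: "cell_at (cs @ [blank]) = cell_at cs"
  by (auto simp: cell_at_def nth_append fun_eq_iff)

lemma cell_at_append_Cons:
  "cell_at (p @ c # s) n = (if n = length p then c else cell_at (p @ c' # s) n)"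
  by (auto simp: cell_at_def nth_append nth_Cons split: nat.split)

lemma cell_at_length_le:
  assumes "cell_at cs = cell_at cs'" "cs' \<noteq> []" "last cs' \<noteq> blank"
  shows "length cs' \<le> length cs"
proof (rule ccontr)
  assume "\<not> length cs' \<le> length cs"
  then have "cell_at cs (length cs' - 1) = blank" "cell_at cs' (length cs' - 1) = last cs'"
    using assms(2) by (auto simp: cell_at_def last_conv_nth)
  then show False
    using assms by simp
qed

definition lamps :: "cell list \<Rightarrow> int \<Rightarrow> bool" where
  "lamps cs i = (if 0 \<le> i then fst (cell_at cs (nat i)) else snd (cell_at cs (nat (- i - 1))))"

lemma cell_at_lamps: "cell_at cs n = (lamps cs (int n), lamps cs (- int n - 1))"
  by (simp add: lamps_def)

lemma lamps_eq_iff: "lamps cs = lamps cs' \<longleftrightarrow> cell_at cs = cell_at cs'"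
proof
  assume "lamps cs = lamps cs'"
  then show "cell_at cs = cell_at cs'"
    by (simp add: cell_at_lamps fun_eq_iff)
next
  assume "cell_at cs = cell_at cs'"
  then show "lamps cs = lamps cs'"
    by (simp add: lamps_def fun_eq_iff)
qed

lemma finite_lamps: "finite {i. lamps cs i}"
proof (rule finite_subset)
  show "{i. lamps cs i} \<subseteq> {- int (length cs) - 1..int (length cs)}"
    by (auto simp: lamps_def cell_at_def split: if_splits)
qed simp

text \<open>The tape is folded at the origin: cell \<open>n\<close> holds the lamps at \<open>n\<close> and \<open>- n - 1\<close>. In
  \<open>(p, d, c, s)\<close> the lamplighter is at the cell \<open>c\<close> after \<open>p\<close>, on the nonnegative side iff \<open>d\<close>.\<close>

type_synonym tape = "cell list \<times> bool \<times> cell \<times> cell list"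

definition tapes :: "tape set" where
  "tapes = {(p, d, c, s). trimmed s}"

definition head_position :: "bool \<Rightarrow> nat \<Rightarrow> int" where
  "head_position d n = (if d then int n else - int n - 1)"

fun config :: "tape \<Rightarrow> (int \<Rightarrow> bool) \<times> int" where
  "config (p, d, c, s) = (lamps (p @ c # s), head_position d (length p))"

lemma head_position_eq_iff: "head_position d n = head_position d' n' \<longleftrightarrow> d = d' \<and> n = n'"
  by (auto simp: head_position_def)

lemma head_position_surj: "\<exists>d n. i = head_position d n"
proof (cases "0 \<le> i")
  case True
  then show ?thesis
    by (intro exI[of _ True] exI[of _ "nat i"]) (simp add: head_position_def)
next
  case False
  then show ?thesis
    by (intro exI[of _ False] exI[of _ "nat (- i - 1)"]) (simp add: head_position_def)
qed

lemma lamps_head_position: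
  "lamps cs (head_position d n) = (if d then fst (cell_at cs n) else snd (cell_at cs n))"
  by (simp add: lamps_def head_position_def)

text \<open>The position determines the side and the length of the prefix. The total length is then
  forced: a nonempty rest ends in a lit cell, which the other tape must reach, while an empty rest
  stops at the head, the shortest possible end.\<close>

lemma inj_on_config: "inj_on config tapes"
proof (rule inj_onI)
  fix x y assume x: "x \<in> tapes" and y: "y \<in> tapes" and eq: "config x = config y"
  obtain p d c s p' d' c' s' where xy: "x = (p, d, c, s)" "y = (p', d', c', s')"
    by (cases x; cases y)
  let ?cs = "p @ c # s" and ?cs' = "p' @ c' # s'"
  have d: "d = d'" "length p = length p'" and cells: "cell_at ?cs = cell_at ?cs'"
    using eq by (auto simp: xy head_position_eq_iff lamps_eq_iff)
  have "length ?cs' \<le> length ?cs" if "s' \<noteq> []"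
    using cell_at_length_le[OF cells] y that by (simp add: xy tapes_def trimmed_def)
  moreover have "length ?cs \<le> length ?cs'" if "s \<noteq> []"
    using cell_at_length_le[OF cells[symmetric]] x that by (simp add: xy tapes_def trimmed_def)
  ultimately have len: "length ?cs = length ?cs'"
    using d(2) by (cases "s = []"; cases "s' = []") auto
  have "?cs = ?cs'"
  proof (rule nth_equalityI[OF len])
    fix n assume "n < length ?cs"
    then show "?cs ! n = ?cs' ! n"
      using fun_cong[OF cells, of n] len unfolding cell_at_def by presburger
  qed
  then show "x = y"
    using d by (simp add: xy)
qed

lemma trim: "\<exists>s'. trimmed s' \<and> cell_at (cs @ s') = cell_at (cs @ s)"
proof (induction s rule: rev_induct)
  case (snoc d s)
  show ?case
  proof (cases "d = blank")
    case True
    then show ?thesis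
      using snoc cell_at_append_blank[of "cs @ s"] by auto
  next
    case False
    then show ?thesis
      by (intro exI[of _ "s @ [d]"]) simp
  qed
qed (auto intro: exI[of _ "[]"])

lemma config_image: "config ` tapes = carrier lamplighter"
proof
  show "config ` tapes \<subseteq> carrier lamplighter"
    using finite_lamps by auto
  show "carrier lamplighter \<subseteq> config ` tapes"
  proof
    fix x assume "x \<in> carrier lamplighter"
    then obtain f k where x: "x = (f, k)" "finite {i. f i}"
      by (cases x) simp
    define g where "g n = (f (int n), f (- int n - 1))" for n
    define d where "d \<longleftrightarrow> 0 \<le> k"
    define h where "h = (if d then nat k else nat (- k - 1))"
    have k: "k = head_position d h"
      by (auto simp: d_def h_def head_position_def)
    obtain m where m: "\<And>i. f i \<Longrightarrow> \<bar>i\<bar> < int m"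
    proof -
      obtain b where "\<forall>x \<in> abs ` {i. f i}. x \<le> b"
        using x(2) by (metis bdd_above_finite bdd_above.E finite_imageI)
      then show thesis
        by (intro that[of "nat (b + 1)"]) force
    qed
    \<comment> \<open>Large enough to include every lit lamp and also the head cell.\<close>
    define n where "n = max m (Suc h)"
    obtain s where s: "trimmed s"
      "cell_at (map g [0..<Suc h] @ s) = cell_at (map g [0..<Suc h] @ map g [Suc h..<n])"
      using trim by blast
    have "[0..<n] = [0..<Suc h] @ [Suc h..<n]"
      using upt_add_eq_append[of 0 "Suc h" "n - Suc h"] by (simp add: n_def del: upt_Suc)
    then have "map g [0..<Suc h] @ map g [Suc h..<n] = map g [0..<n]"
      by (simp only: map_append)
    moreover have "lamps (map g [0..<n]) = f"
    proof
      fix i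
      show "lamps (map g [0..<n]) i = f i"
        using m[of i] by (auto simp: lamps_def cell_at_def g_def n_def)
    qed
    moreover have "lamps (map g [0..<Suc h] @ s) = lamps (map g [0..<Suc h] @ map g [Suc h..<n])"
      unfolding lamps_eq_iff by (rule s(2))
    ultimately have "config (map g [0..<h], d, g h, s) = x"
      by (simp add: x(1) k)
    moreover have "(map g [0..<h], d, g h, s) \<in> tapes"
      using s(1) by (simp add: tapes_def)
    ultimately show "x \<in> config ` tapes"
      by blast
  qed
qed

section \<open>Right multiplication by the generators on tapes\<close>

fun lamp_step :: "tape \<Rightarrow> tape" where
  "lamp_step (p, d, c, s) = (p, d, if d then (\<not> fst c, snd c) else (fst c, \<not> snd c), s)"

text \<open>Moving right on the nonnegative side goes away from the fold and may append a blank
  cell. From position -1 to 0 the head stays in its cell and changes side. Elsewhere on the negative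
  side it goes towards the fold, and the abandoned cell is dropped if it would become a trailing
  blank.\<close>

fun move_step :: "tape \<Rightarrow> tape" where
  "move_step (p, True, c, []) = (p @ [c], True, blank, [])"
| "move_step (p, True, c, e # s) = (p @ [c], True, e, s)"
| "move_step ([], False, c, s) = ([], True, c, s)"
| "move_step (e # p, False, c, s) =
     (butlast (e # p), False, last (e # p), if s = [] \<and> c = blank then [] else c # s)"

lemma lamp_step:
  assumes "x \<in> tapes"
  shows "lamp_step x \<in> tapes" "config (lamp_step x) = config x \<otimes>\<^bsub>lamplighter\<^esub> lamp_gen"
proof -
  obtain p d c s where x: "x = (p, d, c, s)"
    by (cases x)
  show "lamp_step x \<in> tapes"
    using assms by (simp add: x tapes_def)
  let ?c' = "if d then (\<not> fst c, snd c) else (fst c, \<not> snd c)"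
  have "lamps (p @ ?c' # s) i = (lamps (p @ c # s) i \<noteq> (i = head_position d (length p)))" for i
  proof -
    obtain e n where i: "i = head_position e n"
      using head_position_surj by blast
    have "cell_at (p @ ?c' # s) n = (if n = length p then ?c' else cell_at (p @ c # s) n)"
      by (rule cell_at_append_Cons)
    moreover have "cell_at (p @ c # s) (length p) = c"
      by (simp add: cell_at_def)
    ultimately show ?thesis
      unfolding i lamps_head_position head_position_eq_iff by auto
  qed
  then show "config (lamp_step x) = config x \<otimes>\<^bsub>lamplighter\<^esub> lamp_gen"
    by (auto simp: x lamp_gen_def fun_eq_iff)
qed

lemma move_step:
  assumes "x \<in> tapes"
  shows "move_step x \<in> tapes" "config (move_step x) = config x \<otimes>\<^bsub>lamplighter\<^esub> move_gen"
proof -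
  have tapes: "(p, d, c, s) \<in> tapes \<longleftrightarrow> trimmed s" for p d c s
    by (simp add: tapes_def)
  have lamps_blank: "lamps (cs @ [blank]) = lamps cs" for cs
    by (simp add: lamps_eq_iff)
  have "move_step x \<in> tapes \<and> config (move_step x) = config x \<otimes>\<^bsub>lamplighter\<^esub> move_gen"
    using assms
  proof (cases x rule: move_step.cases)
    case (1 p c)
    then show ?thesis
      using lamps_blank[of "p @ [c]"] by (simp add: tapes move_gen_def head_position_def)
  next
    case (2 p c e s)
    then show ?thesis
      using assms by (simp add: tapes move_gen_def head_position_def split: if_splits)
  next
    case (3 c s)
    then show ?thesis
      using assms by (simp add: tapes move_gen_def head_position_def)
  next
    case (4 e p c s)
    \<comment> \<open>The head moves onto the last cell of the prefix, so the prefix is split at its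
      right end.\<close>
    define p' e' where "p' = butlast (e # p)" and "e' = last (e # p)"
    have p: "e # p = p' @ [e']"
      by (simp add: p'_def e'_def)
    have step: "move_step x = (p', False, e', if s = [] \<and> c = blank then [] else c # s)"
      unfolding 4 p'_def e'_def by simp
    have x: "x = (p' @ [e'], False, c, s)"
      using 4 p by simp
    show ?thesis
      using assms lamps_blank[of "p' @ [e']"] unfolding step unfolding x
      by (auto simp: tapes move_gen_def head_position_def)
  qed
  then show "move_step x \<in> tapes" "config (move_step x) = config x \<otimes>\<^bsub>lamplighter\<^esub> move_gen"
    by blast+
qed

text \<open>Code \<open>0\<close> marks the cells before the head, \<open>3\<close> those after it, \<open>1\<close> and \<open>2\<close> the cell of
  the head on the nonnegative and the negative side. With these marks every local rule can be
  read off single letters.\<close>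

definition cell_code :: "nat \<Rightarrow> cell \<Rightarrow> nat" where
  "cell_code k c = to_nat (k, c)"

lemma cell_code_eq_iff [simp]: "cell_code k c = cell_code k' c' \<longleftrightarrow> k = k' \<and> c = c'"
  by (auto simp: cell_code_def)

definition tape_alphabet :: "nat set" where
  "tape_alphabet = (\<lambda>(k, c). cell_code k c) ` ({..3} \<times> UNIV)"

lemma finite_tape_alphabet: "finite tape_alphabet"
  by (simp add: tape_alphabet_def)

lemma cell_code_in_alphabet [simp]: "k \<le> 3 \<Longrightarrow> cell_code k c \<in> tape_alphabet"
  by (auto simp: tape_alphabet_def)

definition head_code :: "bool \<Rightarrow> cell \<Rightarrow> nat" where
  "head_code d = cell_code (if d then 1 else 2)"

lemma head_code_eq_iff [simp]: "head_code d c = head_code d' c' \<longleftrightarrow> d = d' \<and> c = c'"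
  "head_code d c \<noteq> cell_code 0 c'" "cell_code 0 c' \<noteq> head_code d c"
  by (auto simp: head_code_def)

lemma head_code_in_alphabet [simp]: "head_code d c \<in> tape_alphabet"
  by (simp add: head_code_def)

fun tape_word :: "tape \<Rightarrow> nat list" where
  "tape_word (p, d, c, s) = map (cell_code 0) p @ head_code d c # map (cell_code 3) s"

text \<open>The prefix is the longest initial run of letters with mark 0, since a head letter
  carries mark 1 or 2; after that the letters decode one by one.\<close>

lemma inj_tape_word: "inj tape_word"
proof (rule injI)
  fix x y assume eq: "tape_word x = tape_word y"
  obtain p d c s p' d' c' s' where xy: "x = (p, d, c, s)" "y = (p', d', c', s')"
    by (cases x; cases y)
  have inj: "inj (cell_code 3)"
    by (auto intro: injI)
  have "p = p' \<and> d = d' \<and> c = c' \<and> s = s'"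
    if "map (cell_code 0) p @ head_code d c # map (cell_code 3) s = map (cell_code 0) p' @ head_code d' c' # map (cell_code 3) s'"
    for p p'
    using that
  proof (induction p p' rule: list_induct2')
    case 1
    then show ?case
      by (simp add: inj_map_eq_map[OF inj])
  qed simp_all
  then show "x = y"
    using eq by (simp add: xy)
qed

lemma tape_word_in_lists: "tape_word x \<in> lists tape_alphabet"
  by (cases x) auto

text \<open>A nonempty trimmed list is an arbitrary list followed by one nonblank cell.\<close>

lemma regular_map_trimmed:
  assumes "finite \<Sigma>" "range f \<subseteq> \<Sigma>"
  shows "regular_language \<Sigma> {map f s | s. trimmed s \<and> s \<noteq> []}" (is "regular_language _ ?L")
    and "regular_language \<Sigma> {map f s | s. trimmed s}"
proof -
  have eq: "?L = {u @ v | u v. u \<in> lists (range f) \<and> v \<in> {k # v | k v. k \<in> f ` (- {blank}) \<and> v \<in> {[]}}}"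
    (is "_ = ?R")
  proof
    show "?L \<subseteq> ?R"
    proof clarify
      fix s assume s: "trimmed s" "s \<noteq> []"
      then have "map f s = map f (butlast s) @ [f (last s)]" "last s \<noteq> blank"
        using append_butlast_last_id[OF s(2)] by (metis list.simps(8,9) map_append, simp add: trimmed_def)
      then show "\<exists>u v. map f s = u @ v \<and> u \<in> lists (range f) \<and>
          v \<in> {k # v | k v. k \<in> f ` (- {blank}) \<and> v \<in> {[]}}"
        by (intro exI[of _ "map f (butlast s)"] exI[of _ "[f (last s)]"]) auto
    qed
    show "?R \<subseteq> ?L"
    proof
      fix w assume "w \<in> ?R"
      then obtain u d where w: "w = u @ [f d]" "u \<in> lists (range f)" "d \<noteq> blank"
        by auto
      then obtain s where "u = map f s"
        by (auto simp: lists_image)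
      then show "w \<in> ?L"
        using w by (intro CollectI exI[of _ "s @ [d]"]) simp
    qed
  qed
  show L: "regular_language \<Sigma> ?L"
    unfolding eq
    by (intro regular_prepend_lists regular_prepend_letter regular_Nil) (use assms in auto)
  have "{map f s | s. trimmed s} = {[]} \<union> ?L"
    by (auto intro: exI[of _ "[]"])
  then show "regular_language \<Sigma> {map f s | s. trimmed s}"
    using regular_Un[OF regular_Nil[OF assms(1)] L] by simp
qed

text \<open>Serves the cell next to the head, whose letter is coded by \<open>g\<close> because its
  mark changes. It must be nonblank only if it is the last cell.\<close>

lemma regular_Cons_map_trimmed:
  assumes "finite \<Sigma>" "range f \<subseteq> \<Sigma>" "range g \<subseteq> \<Sigma>"
  shows "regular_language \<Sigma> {g d # map f s | d s. trimmed (d # s)}"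
proof -
  have eq: "{g d # map f s | d s. trimmed (d # s)} =
      {k # v | k v. k \<in> g ` (- {blank}) \<and> v \<in> {[]}} \<union>
      {k # v | k v. k \<in> range g \<and> v \<in> {map f s | s. trimmed s \<and> s \<noteq> []}}"
    by (auto split: if_splits)
  show ?thesis
    unfolding eq
    by (intro regular_Un regular_prepend_letter regular_Nil regular_map_trimmed) (use assms in auto)
qed

lemma regular_map_append:
  assumes "regular_language \<Sigma> L" "range f \<subseteq> \<Sigma>"
  shows "regular_language \<Sigma> {map f p @ w | p w. w \<in> L}"
proof -
  have "{map f p @ w | p w. w \<in> L} = {u @ w | u w. u \<in> lists (range f) \<and> w \<in> L}"
    by (auto simp: lists_image simp del: in_lists_conv_set)
  then show ?thesis
    using regular_prepend_lists[OF assms] by simp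
qed

lemma regular_tape_words: "regular_language tape_alphabet (tape_word ` tapes)"
proof -
  let ?H = "range (head_code True) \<union> range (head_code False)"
  have eq: "tape_word ` tapes =
      {map (cell_code 0) p @ w | p w. w \<in> {k # v | k v. k \<in> ?H \<and> v \<in> {map (cell_code 3) s | s. trimmed s}}}"
    (is "_ = ?R")
  proof
    show "tape_word ` tapes \<subseteq> ?R"
    proof clarify
      fix p d c s assume "(p, d, c, s) \<in> tapes"
      moreover have "head_code d c \<in> ?H"
        by (cases d) auto
      ultimately show "\<exists>p' w. tape_word (p, d, c, s) = map (cell_code 0) p' @ w \<and>
          w \<in> {k # v | k v. k \<in> ?H \<and> v \<in> {map (cell_code 3) s | s. trimmed s}}"
        by (intro exI[of _ p] exI[of _ "head_code d c # map (cell_code 3) s"]) (auto simp: tapes_def)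
    qed
    show "?R \<subseteq> tape_word ` tapes"
    proof clarify
      fix p k s assume "k \<in> ?H" and s: "trimmed s"
      then obtain d c where "k = head_code d c"
        by auto
      then have "map (cell_code 0) p @ k # map (cell_code 3) s = tape_word (p, d, c, s)"
        by simp
      then show "map (cell_code 0) p @ k # map (cell_code 3) s \<in> tape_word ` tapes"
        using s unfolding tapes_def by blast
    qed
  qed
  show ?thesis
    unfolding eq
    by (intro regular_map_append regular_prepend_letter regular_map_trimmed)
       (auto intro: finite_tape_alphabet)
qed

section \<open>Recognizability of the two generator relations\<close>

abbreviation both :: "nat \<Rightarrow> nat \<Rightarrow> nat option list" where
  "both a b \<equiv> [Some a, Some b]"

lemma both_in_padded_alphabet [simp]:
  "a \<in> \<Sigma> \<Longrightarrow> b \<in> \<Sigma> \<Longrightarrow> both a b \<in> padded_alphabet 2 \<Sigma>"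
  "a \<in> \<Sigma> \<Longrightarrow> [Some a, None] \<in> padded_alphabet 2 \<Sigma>"
  "b \<in> \<Sigma> \<Longrightarrow> [None, Some b] \<in> padded_alphabet 2 \<Sigma>"
  by (auto simp: padded_alphabet_def)

lemma finite_padded_alphabet: "finite \<Sigma> \<Longrightarrow> finite (padded_alphabet n \<Sigma>)"
  using finite_lists_length_eq[of "insert None (Some ` \<Sigma>)" n]
  by (simp add: padded_alphabet_def conj_commute)

lemma convolution_pair_same_map:
  "convolution [map f xs @ u, map f xs @ v] = map (\<lambda>x. [Some (f x), Some (f x)]) xs @ convolution [u, v]"
  by (induction xs) simp_all

lemma convolution_pair_map:
  "convolution [map f xs, map f xs] = map (\<lambda>x. [Some (f x), Some (f x)]) xs"
  using convolution_pair_same_map[of f xs "[]" "[]"] by simp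

abbreviation before2 :: "cell \<Rightarrow> nat option list" where
  "before2 c \<equiv> both (cell_code 0 c) (cell_code 0 c)"

abbreviation after2 :: "cell \<Rightarrow> nat option list" where
  "after2 c \<equiv> both (cell_code 3 c) (cell_code 3 c)"

lemma regular_lamp_step:
  "regular_language (padded_alphabet 2 tape_alphabet)
     ((\<lambda>x. convolution [tape_word x, tape_word (lamp_step x)]) ` tapes)"
proof -
  let ?h = "\<lambda>d c. both (head_code d c) (head_code d (if d then (\<not> fst c, snd c) else (fst c, \<not> snd c)))"
  let ?H = "range (?h True) \<union> range (?h False)"
  have conv: "convolution [tape_word (p, d, c, s), tape_word (lamp_step (p, d, c, s))] =
      map before2 p @ ?h d c # map after2 s" for p d c s
    by (simp add: convolution_pair_same_map convolution_pair_map)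
  have eq: "(\<lambda>x. convolution [tape_word x, tape_word (lamp_step x)]) ` tapes =
      {map before2 p @ w | p w. w \<in> {k # v | k v. k \<in> ?H \<and> v \<in> {map after2 s | s. trimmed s}}}"
    (is "?f ` _ = ?R")
  proof
    show "?f ` tapes \<subseteq> ?R"
    proof clarify
      fix p d c s assume "(p, d, c, s) \<in> tapes"
      moreover have "?h d c \<in> ?H"
        by (cases d) auto
      ultimately show "\<exists>p' w. convolution [tape_word (p, d, c, s), tape_word (lamp_step (p, d, c, s))] =
          map before2 p' @ w \<and> w \<in> {k # v | k v. k \<in> ?H \<and> v \<in> {map after2 s | s. trimmed s}}"
        unfolding conv
        by (intro exI[of _ p] exI[of _ "?h d c # map after2 s"]) (auto simp: tapes_def)
    qed
    show "?R \<subseteq> ?f ` tapes"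
    proof clarify
      fix p k s assume "k \<in> ?H" and s: "trimmed s"
      then obtain d c where "k = ?h d c"
        by blast
      then have "map before2 p @ k # map after2 s = ?f (p, d, c, s)"
        unfolding conv by simp
      then show "map before2 p @ k # map after2 s \<in> ?f ` tapes"
        using s unfolding tapes_def by blast
    qed
  qed
  show ?thesis
    unfolding eq
    by (intro regular_map_append regular_prepend_letter regular_map_trimmed)
       (auto intro: finite_padded_alphabet finite_tape_alphabet)
qed

text \<open>Only two adjacent letters change, or one at the turn. The names say what happens to the
  cell, primes marking the negative side. \<open>new\<close> and \<open>old\<close> carry the
  padding symbol, for a tape growing or shrinking by one cell. \<open>Turn\<close> has no prefix
  since the side changes only in cell 0.\<close>

lemma regular_move_step:
  "regular_language (padded_alphabet 2 tape_alphabet)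
     ((\<lambda>x. convolution [tape_word x, tape_word (move_step x)]) ` tapes)"
proof -
  define f where "f x = convolution [tape_word x, tape_word (move_step x)]" for x
  define leave where "leave c = both (head_code True c) (cell_code 0 c)" for c
  define enter where "enter c = both (cell_code 3 c) (head_code True c)" for c
  define new where "new = [None, Some (head_code True blank)]"
  define turn where "turn c = both (head_code False c) (head_code True c)" for c
  define enter' where "enter' c = both (cell_code 0 c) (head_code False c)" for c
  define leave' where "leave' c = both (head_code False c) (cell_code 3 c)" for c
  define old where "old = [Some (head_code False blank), None]"
  define Right where "Right = {k # v | k v. k \<in> range leave \<and>
    v \<in> {enter d # map after2 s | d s. trimmed (d # s)} \<union> {k # v | k v. k \<in> {new} \<and> v \<in> {[]}}}"
  define Turn where "Turn = {k # v | k v. k \<in> range turn \<and> v \<in> {map after2 s | s. trimmed s}}"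
  define Left where "Left = {k # v | k v. k \<in> range enter' \<and>
    v \<in> {leave' d # map after2 s | d s. trimmed (d # s)} \<union> {k # v | k v. k \<in> {old} \<and> v \<in> {[]}}}"
  have Right: "v \<in> Right \<longleftrightarrow> (\<exists>c. v = [leave c, new]) \<or>
      (\<exists>c e s. v = leave c # enter e # map after2 s \<and> trimmed (e # s))" for v
    unfolding Right_def by blast
  have Turn: "v \<in> Turn \<longleftrightarrow> (\<exists>c s. v = turn c # map after2 s \<and> trimmed s)" for v
    unfolding Turn_def by blast
  have Left: "v \<in> Left \<longleftrightarrow> (\<exists>e. v = [enter' e, old]) \<or>
      (\<exists>c e s. v = enter' e # leave' c # map after2 s \<and> trimmed (c # s))" for v
    unfolding Left_def by blast
  have right_end: "f (p, True, c, []) = map before2 p @ [leave c, new]" for p c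
    by (simp add: f_def leave_def new_def convolution_pair_same_map)
  have right_step: "f (p, True, c, e # s) = map before2 p @ leave c # enter e # map after2 s" for p c e s
    by (simp add: f_def leave_def enter_def convolution_pair_same_map convolution_pair_map)
  have turn_step: "f ([], False, c, s) = turn c # map after2 s" for c s
    by (simp add: f_def turn_def convolution_pair_map)
  have step_left: "move_step (p @ [e], False, c, s) = (p, False, e, if s = [] \<and> c = blank then [] else c # s)"
    for p e c s
    using move_step.simps(4)[of "hd (p @ [e])" "tl (p @ [e])" c s] by (cases p) simp_all
  have left_step: "f (p @ [e], False, c, s) = map before2 p @ enter' e # leave' c # map after2 s"
    if "trimmed (c # s)" for p e c s
    using that unfolding f_def step_left
    by (auto simp: enter'_def leave'_def convolution_pair_same_map convolution_pair_map split: if_splits)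
  have left_end: "f (p @ [e], False, blank, []) = map before2 p @ [enter' e, old]" for p e
    unfolding f_def step_left by (simp add: enter'_def old_def convolution_pair_same_map)
  have "f ` tapes = {map before2 p @ w | p w. w \<in> Right} \<union> Turn \<union> {map before2 p @ w | p w. w \<in> Left}"
    (is "_ = ?R1 \<union> _ \<union> ?R2")
  proof (intro equalityI subsetI)
    fix w assume "w \<in> f ` tapes"
    then obtain p d c s where w: "w = f (p, d, c, s)" and s: "trimmed s"
      by (auto simp: tapes_def)
    \<comment> \<open>On the negative side the abandoned cell \<open>c\<close> joins the rest, so
      the split asks whether \<open>c # s\<close> is trimmed.\<close>
    consider "d" "s = []" | e s' where "d" "s = e # s'" | "\<not> d" "p = []"
      | p' e where "\<not> d" "p = p' @ [e]" "trimmed (c # s)"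
      | p' e where "\<not> d" "p = p' @ [e]" "c = blank" "s = []"
      using s by (cases d; cases s; cases p rule: rev_cases) auto
    then show "w \<in> ?R1 \<union> Turn \<union> ?R2"
    proof cases
      case 1
      then have "w = map before2 p @ [leave c, new]"
        using w right_end by simp
      moreover have "[leave c, new] \<in> Right"
        unfolding Right by blast
      ultimately show ?thesis
        by blast
    next
      case 2
      then have "w = map before2 p @ leave c # enter e # map after2 s'"
        using w right_step by simp
      moreover have "leave c # enter e # map after2 s' \<in> Right"
        using s 2 unfolding Right by blast
      ultimately show ?thesis
        by blast
    next
      case 3
      then have "w = turn c # map after2 s"
        using w turn_step by simp
      then show ?thesis
        using s Turn by blast
    next
      case 4
      then have "w = map before2 p' @ enter' e # leave' c # map after2 s"
        using w left_step by simp
      moreover have "enter' e # leave' c # map after2 s \<in> Left"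
        using 4(3) unfolding Left by blast
      ultimately show ?thesis
        by blast
    next
      case 5
      then have "w = map before2 p' @ [enter' e, old]"
        using w left_end by simp
      moreover have "[enter' e, old] \<in> Left"
        unfolding Left by blast
      ultimately show ?thesis
        by blast
    qed
  next
    have tape: "f (p, d, c, s) \<in> f ` tapes" if "trimmed s" for p d c s
      using that by (simp add: tapes_def)
    have trimmed_tl: "trimmed s" if "trimmed (c # s)" for c s
      using that by (cases s) auto
    fix w assume "w \<in> ?R1 \<union> Turn \<union> ?R2"
    then consider (right) p v where "w = map before2 p @ v" "v \<in> Right" | (turn) "w \<in> Turn"
      | (left) p v where "w = map before2 p @ v" "v \<in> Left"
      by blast
    then show "w \<in> f ` tapes"
    proof cases
      case (right p v)
      from right(2)[unfolded Right] show ?thesis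
      proof (elim disjE exE conjE)
        fix c assume "v = [leave c, new]"
        then show ?thesis
          using tape[of "[]" p True c] right_end \<open>w = _\<close> by simp
      next
        fix c e s assume "v = leave c # enter e # map after2 s" "trimmed (e # s)"
        then show ?thesis
          using tape[of "e # s" p True c] \<open>w = _\<close> right_step by simp
      qed
    next
      case turn
      from turn[unfolded Turn] show ?thesis
      proof (elim exE conjE)
        fix c s assume "w = turn c # map after2 s" "trimmed s"
        then show ?thesis
          using tape[of s "[]" False c] turn_step by simp
      qed
    next
      case (left p v)
      from left(2)[unfolded Left] show ?thesis
      proof (elim disjE exE conjE)
        fix e assume "v = [enter' e, old]"
        then show ?thesis
          using tape[of "[]" "p @ [e]" False blank] left_end \<open>w = _\<close> by simp
      next
        fix c e s assume "v = enter' e # leave' c # map after2 s" and s: "trimmed (c # s)"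
        then show ?thesis
          using tape[OF trimmed_tl[OF s], of "p @ [e]" False c] left_step[OF s] \<open>w = _\<close> by simp
      qed
    qed
  qed
  also have "regular_language (padded_alphabet 2 tape_alphabet) \<dots>"
    unfolding Right_def Turn_def Left_def
    by (intro regular_Un regular_map_append regular_prepend_letter regular_Nil
        regular_map_trimmed regular_Cons_map_trimmed)
       (auto simp: leave_def enter_def new_def turn_def enter'_def leave'_def old_def
          intro: finite_padded_alphabet finite_tape_alphabet)
  finally show ?thesis
    by (simp add: f_def)
qed

text \<open>Since normal forms are unique, the multiplication relation is exactly the graph of
  \<open>step\<close>.\<close>

lemma fa_recognizable_step:
  assumes \<nu>: "\<And>t. t \<in> tapes \<Longrightarrow> \<nu> (tape_word t) = config t"
    and step: "\<And>t. t \<in> tapes \<Longrightarrow> step t \<in> tapes \<and> config (step t) = config t \<otimes>\<^bsub>lamplighter\<^esub> x"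
    and reg: "regular_language (padded_alphabet 2 tape_alphabet)
      ((\<lambda>t. convolution [tape_word t, tape_word (step t)]) ` tapes)"
  shows "fa_recognizable 2 tape_alphabet
    {[u, v] | u v. u \<in> tape_word ` tapes \<and> v \<in> tape_word ` tapes \<and> \<nu> u \<otimes>\<^bsub>lamplighter\<^esub> x = \<nu> v}"
    (is "fa_recognizable _ _ ?R")
proof -
  have eq: "?R = (\<lambda>t. [tape_word t, tape_word (step t)]) ` tapes"
  proof (intro equalityI subsetI)
    fix r assume "r \<in> ?R"
    then obtain t t' where t: "t \<in> tapes" "t' \<in> tapes" "r = [tape_word t, tape_word t']"
      "config t \<otimes>\<^bsub>lamplighter\<^esub> x = config t'"
      using \<nu> by auto
    then have "t' = step t"
      using step inj_onD[OF inj_on_config] by metis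
    then show "r \<in> (\<lambda>t. [tape_word t, tape_word (step t)]) ` tapes"
      using t by blast
  next
    fix r assume "r \<in> (\<lambda>t. [tape_word t, tape_word (step t)]) ` tapes"
    then obtain t where t: "t \<in> tapes" "r = [tape_word t, tape_word (step t)]"
      by blast
    then have "\<nu> (tape_word t) \<otimes>\<^bsub>lamplighter\<^esub> x = \<nu> (tape_word (step t))"
      using \<nu> step by metis
    then show "r \<in> ?R"
      using t step by blast
  qed
  have "(\<lambda>t. [tape_word t, tape_word (step t)]) ` tapes \<subseteq> {ws. length ws = 2 \<and> set ws \<subseteq> lists tape_alphabet}"
    using tape_word_in_lists by (intro image_subsetI) (simp del: in_lists_conv_set)
  then show ?thesis
    using reg unfolding fa_recognizable_def eq image_image by blast
qed

lemma graph_automatic_lamplighter: "graph_automatic_wrt lamplighter {lamp_gen, move_gen}"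
proof -
  define \<nu> where "\<nu> = config \<circ> inv_into tapes tape_word"
  have inj: "inj_on tape_word tapes"
    using inj_tape_word by (rule inj_on_subset) simp
  have \<nu>: "\<nu> (tape_word t) = config t" if "t \<in> tapes" for t
    using that inj by (simp add: \<nu>_def)
  have "bij_betw (inv_into tapes tape_word) (tape_word ` tapes) tapes"
    using inj by (simp add: bij_betw_inv_into inj_on_imp_bij_betw)
  moreover have "bij_betw config tapes (carrier lamplighter)"
    using inj_on_config config_image by (simp add: bij_betw_def)
  ultimately have "bij_betw \<nu> (tape_word ` tapes) (carrier lamplighter)"
    unfolding \<nu>_def by (rule bij_betw_trans)
  then show ?thesis
    unfolding graph_automatic_wrt_def
    using finite_tape_alphabet regular_tape_words
      fa_recognizable_step[OF \<nu> _ regular_lamp_step] lamp_step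
      fa_recognizable_step[OF \<nu> _ regular_move_step] move_step
    by (intro exI[of _ tape_alphabet] exI[of _ "tape_word ` tapes"] exI[of _ \<nu>]) auto
qed

subsection \<open>Transport to the natural numbers\<close>

text \<open>Conjugates of the lamp by shifts light any single lamp, products of these any finite
  set, and a final shift places the head.\<close>

lemma lamplighter_generators: "finite_generating_set lamplighter {lamp_gen, move_gen}"
proof -
  let ?X = "{lamp_gen, move_gen}"
  interpret group lamplighter
    by (rule group_lamplighter)
  have X: "?X \<subseteq> carrier lamplighter"
    by (simp add: lamp_gen_def move_gen_def)
  interpret gen: subgroup "generate lamplighter ?X" lamplighter
    using X by (rule generate_is_subgroup)
  have lamp: "lamp_gen \<in> generate lamplighter ?X" and move: "move_gen \<in> generate lamplighter ?X"
    by (auto intro: generate.incl)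
  have shift_nat: "(\<lambda>i. False, int n) \<in> generate lamplighter ?X" for n
  proof (induction n)
    case 0
    then show ?case
      using gen.one_closed by simp
  next
    case (Suc n)
    then show ?case
      using gen.m_closed[OF Suc move] by (simp add: move_gen_def algebra_simps)
  qed
  have shift_neg: "(\<lambda>i. False, - int n) \<in> generate lamplighter ?X" for n
  proof -
    have "inv\<^bsub>lamplighter\<^esub> (\<lambda>i. False, int n) = (\<lambda>i. False, - int n)"
      by (rule inv_equality) auto
    then show ?thesis
      using gen.m_inv_closed[OF shift_nat[of n]] by simp
  qed
  have shift: "(\<lambda>i. False, k) \<in> generate lamplighter ?X" for k
    using shift_nat[of "nat k"] shift_neg[of "nat (- k)"] by (cases "0 \<le> k") auto
  have single: "(\<lambda>i. i = k, 0) \<in> generate lamplighter ?X" for k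
  proof -
    have "(\<lambda>i. i = k, 0) = (\<lambda>i. False, k) \<otimes>\<^bsub>lamplighter\<^esub> lamp_gen \<otimes>\<^bsub>lamplighter\<^esub> (\<lambda>i. False, - k)"
      by (auto simp: lamp_gen_def)
    then show ?thesis
      using shift lamp gen.m_closed by metis
  qed
  have lamps: "(\<lambda>i. i \<in> A, 0) \<in> generate lamplighter ?X" if "finite A" for A
    using that
  proof (induction A)
    case empty
    then show ?case
      using gen.one_closed by simp
  next
    case (insert a A)
    then have "(\<lambda>i. i \<in> insert a A) = (\<lambda>i. (i = a) \<noteq> (i \<in> A))"
      by auto
    then have "(\<lambda>i. i \<in> insert a A, 0) = (\<lambda>i. i = a, 0) \<otimes>\<^bsub>lamplighter\<^esub> (\<lambda>i. i \<in> A, 0)"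
      by simp
    then show ?case
      using single insert.IH gen.m_closed by metis
  qed
  have "(f, k) \<in> generate lamplighter ?X" if "finite {i. f i}" for f k
  proof -
    have "(f, k) = (\<lambda>i. i \<in> {i. f i}, 0) \<otimes>\<^bsub>lamplighter\<^esub> (\<lambda>i. False, k)"
      by simp
    then show ?thesis
      using lamps[OF that] shift gen.m_closed by metis
  qed
  then have "carrier lamplighter \<subseteq> generate lamplighter ?X"
    by auto
  then show ?thesis
    using X gen.subset by (auto simp: finite_generating_set_def)
qed

text \<open>The language and all relations on words stay the same; only the naming map is composed
  with \<open>h\<close>.\<close>

lemma graph_automatic_iso:
  assumes "group G" "group H" "h \<in> iso G H" "graph_automatic G"
  shows "graph_automatic H"
proof -
  interpret group_hom G H h
    by (intro group_hom.intro group_hom_axioms.intro assms(1,2) iso_imp_homomorphism[OF assms(3)])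
  obtain X where X: "finite_generating_set G X" "graph_automatic_wrt G X"
    using assms(4) by (auto simp: graph_automatic_def)
  from X(2)[unfolded graph_automatic_wrt_def]
  obtain \<Sigma> :: "nat set" and R \<nu> where \<nu>: "finite \<Sigma>" "regular_language \<Sigma> R" "bij_betw \<nu> R (carrier G)"
    and rec: "\<forall>x \<in> X. fa_recognizable 2 \<Sigma> {[u, v] | u v. u \<in> R \<and> v \<in> R \<and> \<nu> u \<otimes>\<^bsub>G\<^esub> x = \<nu> v}"
    by (elim exE conjE) (rule that)
  have X_carrier: "X \<subseteq> carrier G"
    using X(1) by (simp add: finite_generating_set_def)
  have h: "bij_betw h (carrier G) (carrier H)"
    using assms(3) by (simp add: iso_def)
  have "finite_generating_set H (h ` X)"
    using X(1) generate_img[of X] h by (auto simp: finite_generating_set_def bij_betw_def)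
  moreover have "graph_automatic_wrt H (h ` X)"
    unfolding graph_automatic_wrt_def
  proof (intro exI conjI ballI)
    show "bij_betw (h \<circ> \<nu>) R (carrier H)"
      using \<nu>(3) h by (rule bij_betw_trans)
    fix y assume "y \<in> h ` X"
    then obtain x where x: "x \<in> X" "y = h x"
      by blast
    have "(h \<circ> \<nu>) u \<otimes>\<^bsub>H\<^esub> y = (h \<circ> \<nu>) v \<longleftrightarrow> \<nu> u \<otimes>\<^bsub>G\<^esub> x = \<nu> v" if "u \<in> R" "v \<in> R" for u v
    proof -
      have c: "\<nu> u \<in> carrier G" "\<nu> v \<in> carrier G" "x \<in> carrier G"
        using bij_betwE[OF \<nu>(3)] that x(1) X_carrier by auto
      then have "(h \<circ> \<nu>) u \<otimes>\<^bsub>H\<^esub> y = h (\<nu> u \<otimes>\<^bsub>G\<^esub> x)"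
        by (simp add: x(2))
      moreover have "inj_on h (carrier G)"
        using h by (simp add: bij_betw_def)
      ultimately show ?thesis
        using inj_on_eq_iff[OF _ G.m_closed[OF c(1,3)] c(2)] by (simp del: hom_mult)
    qed
    then have "{[u, v] | u v. u \<in> R \<and> v \<in> R \<and> (h \<circ> \<nu>) u \<otimes>\<^bsub>H\<^esub> y = (h \<circ> \<nu>) v} =
        {[u, v] | u v. u \<in> R \<and> v \<in> R \<and> \<nu> u \<otimes>\<^bsub>G\<^esub> x = \<nu> v}"
      by blast
    then show "fa_recognizable 2 \<Sigma>
        {[u, v] | u v. u \<in> R \<and> v \<in> R \<and> (h \<circ> \<nu>) u \<otimes>\<^bsub>H\<^esub> y = (h \<circ> \<nu>) v}"
      using rec x(1) by simp
  qed (use \<nu> in auto)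
  ultimately show ?thesis
    unfolding graph_automatic_def by blast
qed

lemma transport_group:
  fixes h :: "'a \<Rightarrow> 'b"
  assumes "group G" "inj_on h (carrier G)"
  obtains H :: "'b monoid" where "group H" "h \<in> iso G H"
proof -
  interpret group G by fact
  define k where "k = inv_into (carrier G) h"
  have k: "k (h x) = x" if "x \<in> carrier G" for x
    using assms(2) that by (simp add: k_def)
  define H where "H = \<lparr>carrier = h ` carrier G, monoid.mult = \<lambda>x y. h (k x \<otimes>\<^bsub>G\<^esub> k y), one = h \<one>\<^bsub>G\<^esub>\<rparr>"
  \<comment> \<open>Monoid laws suffice here: inverses come from the isomorphism with a
    group.\<close>
  have "monoid H"
    by (rule monoidI) (auto simp: H_def k m_assoc)
  moreover have "h \<in> iso G H"
    using assms(2) by (auto simp: iso_def hom_def H_def k bij_betw_def)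
  ultimately show thesis
    using that iso_imp_group by (auto simp: is_iso_def)
qed

theorem corollary10p7:
  "\<exists>G :: nat monoid. group G \<and> graph_automatic G \<and> \<not> finitely_presented G \<and> \<not> automatic G"
proof -
  \<comment> \<open>The ambient type is uncountable but the carrier is not: every element is named
    by a tape, and the type of tapes is countable.\<close>
  define h :: "(int \<Rightarrow> bool) \<times> int \<Rightarrow> nat" where "h = to_nat \<circ> inv_into tapes config"
  have "inj_on h (carrier lamplighter)"
    using inj_on_inv_into[of "carrier lamplighter" config tapes] config_image
    by (simp add: h_def comp_inj_on)
  then obtain G :: "nat monoid" where G: "group G" "h \<in> iso lamplighter G"
    using transport_group[OF group_lamplighter] by blast
  have "graph_automatic lamplighter"
    using lamplighter_generators graph_automatic_lamplighter by (auto simp: graph_automatic_def)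
  then have "graph_automatic G"
    using graph_automatic_iso[OF group_lamplighter G] by blast
  moreover have "\<not> partial_homs_extend G"
    using partial_homs_extend_iso[OF G(1) group_lamplighter]
      group.iso_set_sym[OF group_lamplighter G(2)] lamplighter_not_partial_homs_extend by blast
  then have "\<not> finitely_presented G" "\<not> automatic G"
    using finitely_presented_partial_homs_extend[OF G(1)] group.automatic_partial_homs_extend[OF G(1)]
    by blast+
  ultimately show ?thesis
    using G(1) by blast
qed

end
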